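(* Let $c>\frac12$ be a constant. Then for any $p=p(n)$ with $\frac{c\ln n}{n}\le p\le \frac12$, a random sample $G$ from $G(n,p)$ satisfies $$\operatorname{rank}(Q_G)=n-i(G)$$ with probability $1-O\big((\ln\ln n)^{-1/4}\big)$ as $n\to\infty$.
   Context: $G(n,p)$ is the Erdős–Rényi random graph on the vertex set $\{1,\dots,n\}$: each pair of distinct vertices is joined by an edge independently with probability $p$. For a simple graph $G$ on $\{1,\dots,n\}$, $Q_G$ is its adjacency matrix (the symmetric $n\times n$ matrix whose $ij$ entry is $1$ if $i$ and $j$ are adjacent and $0$ otherwise); its rank is taken over the real numbers. A vertex is isolated if it has no neighbor, and $i(G)$ is the number of isolated vertices of $G$. The implied constant in $O(\cdot)$ may depend on $c$; $n$ is assumed sufficiently large. *)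

theory Defs
  imports "HOL-Probability.Probability" "Jordan_Normal_Form.DL_Rank"
begin

text \<open>
  A simple graph on \<open>{1..n}\<close> is represented by its edge set, a set of two-element
  subsets of \<open>{1..n}\<close>.
\<close>

definition vertex_pairs :: "nat \<Rightarrow> nat set set" where
  "vertex_pairs n = {e. e \<subseteq> {1..n} \<and> card e = 2}"

definition adjacent :: "nat set set \<Rightarrow> nat \<Rightarrow> nat \<Rightarrow> bool" where
  "adjacent E v w \<longleftrightarrow> {v, w} \<in> E"

definition random_graph :: "nat \<Rightarrow> real \<Rightarrow> nat set set pmf" where
  "random_graph n p =
     map_pmf (\<lambda>present. {e \<in> vertex_pairs n. present e})
       (Pi_pmf (vertex_pairs n) False (\<lambda>_. bernoulli_pmf p))"

text \<open>
  Matrix indices start at 0, so index \<open>i < n\<close> stands for vertex \<open>Suc i\<close>.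
\<close>

definition adjacency_matrix :: "nat \<Rightarrow> nat set set \<Rightarrow> real mat" where
  "adjacency_matrix n E =
     mat n n (\<lambda>(i, j). if adjacent E (Suc i) (Suc j) then 1 else 0)"

definition isolated_vertices :: "nat \<Rightarrow> nat set set \<Rightarrow> nat set" where
  "isolated_vertices n E = {v \<in> {1..n}. \<not> (\<exists>w \<in> {1..n}. adjacent E v w)}"

definition num_isolated :: "nat \<Rightarrow> nat set set \<Rightarrow> nat" where
  "num_isolated n E = card (isolated_vertices n E)"

end

(*
  A symmetric 0/1 matrix A with rank below n - i(G) has a kernel vector x <> 0 supported on
  non-isolated vertices, and it suffices to show two things, each up to an error that vanishes
  with d = n p.

  (1) The support of x has at least n/4 elements.  If it is a set S with |S| p bounded, then no
  vertex outside S has exactly one neighbour in S, while all vertices of S have a neighbour.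
  Markov's inequality for l^(number of edge ends in S), with l^2 = n / (|S| d^2), and the union
  bound over all S of a given size bound the probability of this by
  (const * sqrt (n/|S|) * d * exp (-d))^|S|, which is where c > 1/2 enters.  If |S| p is large but |S| <= n/4, then |S| of the rows outside S
  determine the solution space, and all remaining rows are orthogonal to a fixed vector with
  support S, which the Littlewood-Offord inequality makes very unlikely.

  (2) Hence for at least a quarter of the vertices v, column v depends on the other ones, and
  singularity costs at most four times the probability of that event for a fixed v.  Let B be the
  adjacency matrix of G - v and a the indicator of the neighbours of v, which is independent of B.
  Either B has a kernel vector with large support, and a is orthogonal to it; or B is invertible on
  the non-isolated vertices, and a is a zero of the quadratic form of the inverse.  By (1), applied
  to B with one row deleted, most columns of this inverse have large support, and decoupling
  reduces the quadratic form to linear ones.  The total error is O((ln n)^(-1/4)).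
*)
theory Submission
  imports Defs "HOL-Real_Asymp.Real_Asymp"
begin

text \<open>The threshold 1/2 is that of two leaves with a common neighbour: their columns are
  equal, and for small p their expected number is about \<open>n * d^2 * exp (- 2 * d)\<close> up to
  a constant, which is the bound in (1) for |S| = 2. Forbidding vertices outside S with exactly one
  neighbour in S only gains about \<open>exp (- d)\<close> per vertex of S, while choosing S costs
  about n / |S| per vertex; this alone would ask for c > 1. The missing factor
  \<open>d * sqrt (|S| / n)\<close> per vertex comes from the condition that no vertex of S is
  isolated, which the moment bound turns into a price for the edges that meet S.

  The same estimates must also serve the columns of the inverse of B. The column at j solves every
  kernel equation except the one at j, so one row is left free throughout (1).

  The exponent 1/4 has two sources: Littlewood-Offord gives d^(-1/2), and decoupling bounds only the
  square of the probability.

  Probabilities are finite weighted sums, so exposing the graph in stages is a rearrangement of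
  sums.\<close>

section \<open>Expectation over a random subset\<close>

text \<open>Every element of \<open>A\<close> belongs to \<open>F\<close> independently with probability \<open>p\<close>.\<close>

definition EE :: "real \<Rightarrow> 'a set \<Rightarrow> ('a set \<Rightarrow> real) \<Rightarrow> real" where
  "EE p A f = (\<Sum>F\<in>Pow A. p ^ card F * (1 - p) ^ card (A - F) * f F)"

abbreviation ind :: "bool \<Rightarrow> real" where "ind \<equiv> of_bool"

lemma EE_cong: "(\<And>F. F \<subseteq> A \<Longrightarrow> f F = g F) \<Longrightarrow> EE p A f = EE p A g"
  unfolding EE_def by (intro sum.cong) auto

lemma EE_mono:
  assumes "0 \<le> p" "p \<le> 1" "\<And>F. F \<subseteq> A \<Longrightarrow> f F \<le> g F"
  shows "EE p A f \<le> EE p A g"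
  unfolding EE_def using assms by (intro sum_mono mult_left_mono) auto

lemma EE_nonneg:
  assumes "0 \<le> p" "p \<le> 1" "\<And>F. F \<subseteq> A \<Longrightarrow> 0 \<le> f F"
  shows "0 \<le> EE p A f"
  unfolding EE_def using assms by (intro sum_nonneg mult_nonneg_nonneg) auto

lemma EE_add: "EE p A (\<lambda>F. f F + g F) = EE p A f + EE p A g"
  unfolding EE_def by (simp add: ring_distribs sum.distrib)

lemma EE_diff: "EE p A (\<lambda>F. f F - g F) = EE p A f - EE p A g"
  unfolding EE_def by (simp add: ring_distribs sum_subtractf)

lemma EE_cmult: "EE p A (\<lambda>F. c * f F) = c * EE p A f"
  unfolding EE_def by (simp add: sum_distrib_left algebra_simps)

lemma EE_multc: "EE p A (\<lambda>F. f F * c) = EE p A f * c"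
  unfolding EE_def by (simp add: sum_distrib_right mult.assoc)

lemma EE_sum: "EE p A (\<lambda>F. \<Sum>i\<in>I. f i F) = (\<Sum>i\<in>I. EE p A (f i))"
  unfolding EE_def by (simp add: sum_distrib_left) (rule sum.swap)

lemma EE_empty [simp]: "EE p {} f = f {}"
  by (simp add: EE_def)

lemma EE_insert:
  assumes "finite A" "a \<notin> A"
  shows "EE p (insert a A) f = p * EE p A (\<lambda>F. f (insert a F)) + (1 - p) * EE p A f"
proof -
  have inj: "inj_on (insert a) (Pow A)"
    using assms by (auto simp: inj_on_def)
  have "EE p (insert a A) f = (\<Sum>F\<in>Pow A. p ^ card F * (1 - p) ^ card (insert a A - F) * f F) +
     (\<Sum>F\<in>insert a ` Pow A. p ^ card F * (1 - p) ^ card (insert a A - F) * f F)"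
    unfolding EE_def Pow_insert using assms by (subst sum.union_disjoint) auto
  also have "(\<Sum>F\<in>Pow A. p ^ card F * (1 - p) ^ card (insert a A - F) * f F) = (1 - p) * EE p A f"
    unfolding EE_def sum_distrib_left
  proof (rule sum.cong)
    fix F assume F: "F \<in> Pow A"
    then have "insert a A - F = insert a (A - F)" using assms by auto
    then have "card (insert a A - F) = Suc (card (A - F))" using assms F by simp
    then show "p ^ card F * (1 - p) ^ card (insert a A - F) * f F = (1 - p) * (p ^ card F * (1 - p) ^ card (A - F) * f F)"
      by simp
  qed simp
  also have "(\<Sum>F\<in>insert a ` Pow A. p ^ card F * (1 - p) ^ card (insert a A - F) * f F)
      = p * EE p A (\<lambda>F. f (insert a F))"
    unfolding EE_def sum_distrib_left sum.reindex[OF inj] o_def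
  proof (rule sum.cong)
    fix F assume F: "F \<in> Pow A"
    then have "insert a A - insert a F = A - F" using assms by auto
    moreover have "card (insert a F) = Suc (card F)"
      using F assms by (metis PowD card_insert_disjoint finite_subset in_mono)
    ultimately show "p ^ card (insert a F) * (1 - p) ^ card (insert a A - insert a F) * f (insert a F)
        = p * (p ^ card F * (1 - p) ^ card (A - F) * f (insert a F))"
      by simp
  qed simp
  finally show ?thesis by simp
qed

lemma EE_const [simp]: "finite A \<Longrightarrow> EE p A (\<lambda>_. c) = c"
  by (induction A rule: finite_induct) (simp_all add: EE_insert algebra_simps)

text \<open>Fubini: the traces of the random set on disjoint ground sets are independent. Every
  conditioning argument below takes this form.\<close>

lemma EE_union:
  assumes "finite A" "finite B" "A \<inter> B = {}"
  shows "EE p (A \<union> B) f = EE p A (\<lambda>F. EE p B (\<lambda>G. f (F \<union> G)))"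
  using assms(1,3)
proof (induction A arbitrary: f rule: finite_induct)
  case (insert a A)
  then have "EE p (insert a A \<union> B) f = p * EE p (A \<union> B) (\<lambda>F. f (insert a F)) + (1 - p) * EE p (A \<union> B) f"
    using assms(2) by (simp add: EE_insert)
  also have "\<dots> = EE p (insert a A) (\<lambda>F. EE p B (\<lambda>G. f (F \<union> G)))"
    using insert by (simp add: EE_insert)
  finally show ?case .
qed simp

lemma EE_swap: "EE p A (\<lambda>F. EE p B (\<lambda>G. f F G)) = EE p B (\<lambda>G. EE p A (\<lambda>F. f F G))"
  unfolding EE_def sum_distrib_left by (subst sum.swap) (simp add: mult.left_commute)

lemma EE_marginal:
  assumes "finite A" "B \<subseteq> A" "\<And>F. F \<subseteq> A \<Longrightarrow> f F = f (F \<inter> B)"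
  shows "EE p A f = EE p B f"
proof -
  have "EE p A f = EE p (B \<union> (A - B)) f" using assms(2) by (simp add: Un_absorb1)
  also have "\<dots> = EE p B (\<lambda>F. EE p (A - B) (\<lambda>G. f (F \<union> G)))"
    using assms by (intro EE_union) (auto intro: finite_subset)
  also have "\<dots> = EE p B (\<lambda>F. EE p (A - B) (\<lambda>G. f F))"
  proof (intro EE_cong)
    fix F G assume "F \<subseteq> B" "G \<subseteq> A - B"
    then have "F \<union> G \<subseteq> A" "(F \<union> G) \<inter> B = F" using assms(2) by auto
    then show "f (F \<union> G) = f F" using assms(3)[of "F \<union> G"] by simp
  qed
  also have "\<dots> = EE p B f" using assms(1) by (intro EE_cong) simp
  finally show ?thesis .
qed

lemma EE_reindex:
  assumes "inj_on \<sigma> I"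
  shows "EE p (\<sigma> ` I) f = EE p I (\<lambda>F. f (\<sigma> ` F))"
proof -
  have "EE p (\<sigma> ` I) f = (\<Sum>F\<in>image \<sigma> ` Pow I. p ^ card F * (1 - p) ^ card (\<sigma> ` I - F) * f F)"
    unfolding EE_def by (simp add: image_Pow_surj)
  also have "\<dots> = (\<Sum>F\<in>Pow I. p ^ card (\<sigma> ` F) * (1 - p) ^ card (\<sigma> ` I - \<sigma> ` F) * f (\<sigma> ` F))"
    using inj_on_image_Pow[OF assms] by (subst sum.reindex) (auto simp: o_def)
  also have "\<dots> = EE p I (\<lambda>F. f (\<sigma> ` F))"
    unfolding EE_def
  proof (rule sum.cong)
    fix F assume "F \<in> Pow I"
    then have F: "F \<subseteq> I" by simp
    have "\<sigma> ` I - \<sigma> ` F = \<sigma> ` (I - F)"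
      using inj_on_image_set_diff[OF assms, of I F] F by auto
    then show "p ^ card (\<sigma> ` F) * (1 - p) ^ card (\<sigma> ` I - \<sigma> ` F) * f (\<sigma> ` F)
       = p ^ card F * (1 - p) ^ card (I - F) * f (\<sigma> ` F)"
      using card_image[OF inj_on_subset[OF assms F]] card_image[OF inj_on_subset[OF assms, of "I - F"]] by simp
  qed simp
  finally show ?thesis .
qed

lemma EE_prod:
  assumes "finite U" "\<And>u. u \<in> U \<Longrightarrow> finite (R u)"
    and "\<And>u w. u \<in> U \<Longrightarrow> w \<in> U \<Longrightarrow> u \<noteq> w \<Longrightarrow> R u \<inter> R w = {}"
  shows "EE p (\<Union>u\<in>U. R u) (\<lambda>F. \<Prod>u\<in>U. f u (F \<inter> R u)) = (\<Prod>u\<in>U. EE p (R u) (f u))"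
  using assms
proof (induction U rule: finite_induct)
  case (insert u U)
  have disj: "R u \<inter> (\<Union>u\<in>U. R u) = {}"
    using insert.prems(2) insert.hyps(2) by fastforce
  have "EE p (\<Union>u\<in>insert u U. R u) (\<lambda>F. \<Prod>u\<in>insert u U. f u (F \<inter> R u)) =
    EE p (R u) (\<lambda>F. EE p (\<Union>u\<in>U. R u) (\<lambda>G. f u ((F \<union> G) \<inter> R u) * (\<Prod>w\<in>U. f w ((F \<union> G) \<inter> R w))))"
    using insert disj by (simp add: EE_union)
  also have "\<dots> = EE p (R u) (\<lambda>F. EE p (\<Union>u\<in>U. R u) (\<lambda>G. f u F * (\<Prod>w\<in>U. f w (G \<inter> R w))))"
  proof (intro EE_cong arg_cong2[where f = "(*)"] prod.cong refl)
    fix F G assume FG: "F \<subseteq> R u" "G \<subseteq> (\<Union>u\<in>U. R u)"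
    then have "(F \<union> G) \<inter> R u = F" using disj by auto
    then show "f u ((F \<union> G) \<inter> R u) = f u F" by simp
    fix w assume "w \<in> U"
    then have "(F \<union> G) \<inter> R w = G \<inter> R w" using disj FG by auto
    then show "f w ((F \<union> G) \<inter> R w) = f w (G \<inter> R w)" by simp
  qed
  also have "\<dots> = (\<Prod>w\<in>U. EE p (R w) (f w)) * EE p (R u) (f u)"
    using insert by (simp add: EE_cmult EE_multc)
  finally show ?case using insert.hyps by (simp add: mult.commute)
qed simp

text \<open>Nonnegativity of the variance; this is the Cauchy-Schwarz step of the
  decoupling.\<close>

lemma EE_square_le:
  assumes "finite A" "0 \<le> p" "p \<le> 1"
  shows "(EE p A f)\<^sup>2 \<le> EE p A (\<lambda>F. (f F)\<^sup>2)"
proof -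
  define m where "m = EE p A f"
  have "0 \<le> EE p A (\<lambda>F. (f F - m)\<^sup>2)"
    using assms by (intro EE_nonneg) auto
  also have "\<dots> = EE p A (\<lambda>F. ((f F)\<^sup>2 - (2 * m) * f F) + m\<^sup>2)"
    by (intro EE_cong) (simp add: power2_diff)
  also have "\<dots> = EE p A (\<lambda>F. (f F)\<^sup>2) - (2 * m) * m + m\<^sup>2"
    unfolding EE_add EE_diff EE_cmult m_def using assms(1) by simp
  finally show ?thesis by (simp add: m_def power2_eq_square)
qed

lemma EE_power_card:
  assumes "finite A"
  shows "EE p A (\<lambda>F. x ^ card F) = (1 - p + x * p) ^ card A"
  using assms
proof (induction A rule: finite_induct)
  case (insert a A)
  have "EE p A (\<lambda>F. x ^ card (insert a F)) = EE p A (\<lambda>F. x * x ^ card F)"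
  proof (intro EE_cong)
    fix F assume "F \<subseteq> A"
    then have "card (insert a F) = Suc (card F)"
      using insert by (metis card_insert_disjoint finite_subset in_mono)
    then show "x ^ card (insert a F) = x * x ^ card F" by simp
  qed
  then show ?case using insert by (simp add: EE_insert EE_cmult algebra_simps)
qed simp

lemma EE_card_eq_1:
  fixes p :: real
  assumes "finite A"
  shows "EE p A (\<lambda>F. of_bool (card F = 1)) = real (card A) * p * (1 - p) ^ (card A - 1)"
proof -
  have "EE p A (\<lambda>F. of_bool (card F = 1)) = (\<Sum>F\<in>(\<lambda>a. {a}) ` A. p ^ card F * (1 - p) ^ card (A - F))"
    unfolding EE_def using assms
    by (intro sum.mono_neutral_cong_right) (auto simp: card_1_singleton_iff)
  also have "\<dots> = (\<Sum>a\<in>A. p * (1 - p) ^ (card A - 1))"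
    by (subst sum.reindex) (auto simp: inj_on_def card_Diff_singleton)
  finally show ?thesis by simp
qed

section \<open>Littlewood--Offord inequalities\<close>

text \<open>The LYM inequality for the antichain of subsets of weight \<open>b\<close>: \<open>1 / (k choose m)\<close> is the
  sum of \<open>1 / (k - 1 choose m)\<close> over the \<open>k - m\<close> elements \<open>j \<notin> F\<close>, divided by \<open>k\<close>.\<close>

lemma sum_inverse_binomial_level_le_1:
  fixes x :: "'a \<Rightarrow> real"
  assumes "finite I" "\<And>i. i \<in> I \<Longrightarrow> x i > 0"
  shows "(\<Sum>F | F \<subseteq> I \<and> sum x F = b. 1 / real (card I choose card F)) \<le> 1"
  using assms
proof (induction "card I" arbitrary: I)
  case 0
  then have "I = {}" by simp
  have "{F. F \<subseteq> {} \<and> sum x F = b} = (if b = 0 then {{}} else {})" by auto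
  then show ?case using \<open>I = {}\<close> by simp
next
  case (Suc k)
  have fin: "finite {F. F \<subseteq> J \<and> P F}" if "finite J" for J :: "'a set" and P
    by (rule finite_subset[of _ "Pow J"]) (use that in auto)
  show ?case
  proof (cases "sum x I = b")
    \<comment> \<open>No \<open>j\<close> lies outside \<open>I\<close>, so the averaging over
      \<open>j\<close> breaks down for the set \<open>I\<close>; but positivity makes
      \<open>I\<close> the only set of weight \<open>b\<close>.\<close>
    case True
    have "F = I" if "F \<subseteq> I" "sum x F = b" for F
    proof (rule ccontr)
      assume "F \<noteq> I"
      then have "sum x (I - F) > 0"
        using that(1) Suc.prems by (intro sum_pos) auto
      moreover have "sum x I = sum x F + sum x (I - F)"
        using sum.subset_diff[OF that(1) Suc.prems(1)] by (simp add: add.commute)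
      ultimately show False using True that(2) by simp
    qed
    then have "{F. F \<subseteq> I \<and> sum x F = b} = {I}" using True by auto
    then show ?thesis by simp
  next
    case False
    have "(\<Sum>F | F \<subseteq> I \<and> sum x F = b. 1 / real (card I choose card F))
       = (\<Sum>F | F \<subseteq> I \<and> sum x F = b. \<Sum>j\<in>I - F. 1 / (Suc k * real (k choose card F)))"
    proof (rule sum.cong)
      fix F assume "F \<in> {F. F \<subseteq> I \<and> sum x F = b}"
      then have F: "F \<subseteq> I" "F \<noteq> I" using False by auto
      then have lt: "card F < Suc k"
        using Suc.hyps(2) Suc.prems(1) by (metis psubset_card_mono psubsetI)
      have cd: "card (I - F) = Suc k - card F"
        using F Suc.hyps(2) Suc.prems(1) by (simp add: card_Diff_subset finite_subset)
      have "(Suc k - card F) * (Suc k choose card F) = Suc k * (k choose card F)"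
        using binomial_absorb_comp[of "Suc k" "card F"] by simp
      then have "real (Suc k - card F) * real (Suc k choose card F) = Suc k * real (k choose card F)"
        by (metis of_nat_mult)
      moreover have "real (Suc k choose card F) > 0" "real (k choose card F) > 0"
        using lt by auto
      ultimately show "1 / real (card I choose card F) = (\<Sum>j\<in>I - F. 1 / (Suc k * real (k choose card F)))"
        by (simp add: cd flip: Suc.hyps(2) del: binomial_Suc_Suc of_nat_Suc)
           (simp add: field_simps del: binomial_Suc_Suc of_nat_Suc)
    qed simp
    also have "\<dots> = (\<Sum>j\<in>I. \<Sum>F | F \<subseteq> I - {j} \<and> sum x F = b. 1 / (Suc k * real (k choose card F)))"
    proof -
      have *: "{F. F \<subseteq> I - {j} \<and> sum x F = b} = {F \<in> {F. F \<subseteq> I \<and> sum x F = b}. j \<in> I - F}" if "j \<in> I" for j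
        using that by auto
      have "(\<Sum>j\<in>I. \<Sum>F | F \<subseteq> I - {j} \<and> sum x F = b. 1 / (Suc k * real (k choose card F)))
         = (\<Sum>j\<in>I. \<Sum>F | F \<in> {F. F \<subseteq> I \<and> sum x F = b} \<and> j \<in> I - F. 1 / (Suc k * real (k choose card F)))"
        by (rule sum.cong) (use * in auto)
      also have "\<dots> = (\<Sum>F | F \<subseteq> I \<and> sum x F = b. \<Sum>j | j \<in> I \<and> j \<in> I - F. 1 / (Suc k * real (k choose card F)))"
        by (rule sum.swap_restrict) (use fin Suc.prems(1) in auto)
      also have "\<dots> = (\<Sum>F | F \<subseteq> I \<and> sum x F = b. \<Sum>j\<in>I - F. 1 / (Suc k * real (k choose card F)))"
        by (intro sum.cong) auto
      finally show ?thesis by simp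
    qed
    also have "\<dots> \<le> (\<Sum>j\<in>I. 1 / Suc k)"
    proof (rule sum_mono)
      fix j assume j: "j \<in> I"
      then have k: "k = card (I - {j})" using Suc.hyps(2) by simp
      have "(\<Sum>F | F \<subseteq> I - {j} \<and> sum x F = b. 1 / (Suc k * real (k choose card F)))
        = 1 / Suc k * (\<Sum>F | F \<subseteq> I - {j} \<and> sum x F = b. 1 / real (card (I - {j}) choose card F))"
        by (simp add: sum_distrib_left flip: k)
      also have "\<dots> \<le> 1 / Suc k * 1"
        using Suc.prems by (intro mult_left_mono Suc.hyps(1)[OF k]) auto
      finally show "(\<Sum>F | F \<subseteq> I - {j} \<and> sum x F = b. 1 / (Suc k * real (k choose card F))) \<le> 1 / Suc k"
        by simp
    qed
    also have "\<dots> = 1" using Suc.hyps(2) by (simp del: of_nat_Suc flip: Suc.hyps(2))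
    finally show ?thesis .
  qed
qed

text \<open>The terms within \<open>\<surd>(k p) / 3\<close> of the \<open>m\<close>-th one, on the side of the mean \<open>k p\<close>,
  are at least half as large.\<close>

lemma binomial_term_le:
  fixes p :: real
  assumes p: "0 < p" "p \<le> 1 / 2" and m: "m \<le> k" and k: "k > 0"
  shows "real (k choose m) * p ^ m * (1 - p) ^ (k - m) \<le> 6 / sqrt (k * p)"
proof -
  define q where "q i = real (k choose i) * p ^ i * (1 - p) ^ (k - i)" for i
  define y where "y = k * p"
  define w where "w = nat \<lfloor>sqrt y / 3\<rfloor>"
  have y: "y > 0" using p k by (simp add: y_def)
  have q0: "q i \<ge> 0" for i using p by (simp add: q_def)
  have sumq: "(\<Sum>i\<le>k. q i) = 1"
    using binomial_ring[of p "1 - p" k] by (simp add: q_def)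
  have qm1: "q m \<le> 1"
    using sumq member_le_sum[of m "{..k}" q] q0 m by simp
  have "0 \<le> sqrt y / 3" using y by simp
  then have w_le: "real w \<le> sqrt y / 3" and w_ge: "sqrt y / 3 < real w + 1"
    unfolding w_def by linarith+
  have step: "q (Suc i) * ((i + 1) * (1 - p)) = q i * ((real k - real i) * p)" if "i < k" for i
  proof -
    have "(Suc i) * (k choose Suc i) = (k - i) * (k choose i)"
      using binomial_absorb_comp[of k i] Suc_times_binomial_eq[of "k - 1" i] that k
      by (simp add: mult.commute del: binomial_Suc_Suc)
    then have *: "real (Suc i) * real (k choose Suc i) = real (k - i) * real (k choose i)"
      by (metis of_nat_mult)
    have "k - i = Suc (k - Suc i)" using that by simp
    then have **: "(1 - p) ^ (k - i) = (1 - p) * (1 - p) ^ (k - Suc i)" by simp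
    have "q (Suc i) * ((i + 1) * (1 - p))
      = (real (Suc i) * real (k choose Suc i)) * (p * p ^ i * ((1 - p) * (1 - p) ^ (k - Suc i)))"
      by (simp add: q_def mult_ac)
    also have "\<dots> = q i * (real (k - i) * p)"
      unfolding * q_def ** by (simp only: mult_ac)
    finally show ?thesis using that by (simp add: of_nat_diff add.commute)
  qed
  show ?thesis
  proof (cases "sqrt y \<le> 6")
    case True
    then have "1 \<le> 6 / sqrt y" using y by simp
    then show ?thesis using qm1 unfolding q_def y_def by linarith
  next
    case False
    then have sy: "sqrt y > 6" by simp
    \<comment> \<open>Each step away from \<open>m\<close> towards the mean loses at most a factor
      \<open>1 - \<epsilon>\<close>, and \<open>w * \<epsilon> \<le> 1 / 2\<close>. By Bernoulli's
      inequality at least half of \<open>q m\<close> survives \<open>w\<close> steps.\<close>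
    define \<epsilon> where "\<epsilon> = (2 * real w + 1) / y"
    have yy: "sqrt y * sqrt y = y" using y by simp
    have "(2 * real w + 1) * w \<le> (2 * (sqrt y / 3) + 1) * (sqrt y / 3)"
      using w_le by (intro mult_mono) auto
    also have "\<dots> = 2 / 9 * y + sqrt y / 3" using yy by (simp add: algebra_simps)
    also have "\<dots> \<le> y / 2" using mult_strict_right_mono[OF sy, of "sqrt y"] yy y by simp
    finally have weps: "w * \<epsilon> \<le> 1 / 2" unfolding \<epsilon>_def using y by (simp add: field_simps)
    have "real w > 0" using sy w_ge by linarith
    then have w1: "w \<ge> 1" by simp
    have eps0: "\<epsilon> \<ge> 0" using y by (simp add: \<epsilon>_def)
    have "1 * \<epsilon> \<le> w * \<epsilon>" using w1 eps0 by (intro mult_right_mono) auto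
    then have eps1: "\<epsilon> \<le> 1" using weps by simp
    have half: "1 / 2 \<le> (1 - \<epsilon>) ^ i" if "i \<le> w" for i
    proof -
      have "real i * \<epsilon> \<le> w * \<epsilon>" using that eps0 by (intro mult_right_mono) auto
      moreover have "1 + real i * (- \<epsilon>) \<le> (1 + (- \<epsilon>)) ^ i"
        using eps1 by (intro Bernoulli_inequality) simp
      ultimately show ?thesis using weps by simp
    qed
    have wy: "real w \<le> y" using w_le sy yy mult_strict_right_mono[OF sy, of "sqrt y"] y
      by linarith
    have yk: "y \<le> k / 2" using p k by (simp add: y_def field_simps)
    \<comment> \<open>The window runs from \<open>m\<close> towards the mean, where the terms hardly
      decrease. Upwards it stays below \<open>k\<close> because
      \<open>w \<le> y \<le> k / 2\<close>, downwards it stays nonnegative because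
      \<open>w \<le> y < m\<close>.\<close>
    have "\<exists>J. J \<subseteq> {..k} \<and> card J = w + 1 \<and> (\<forall>j\<in>J. q j \<ge> q m / 2)"
    proof (cases "m \<le> y")
      case True
      have mw: "m + w \<le> k" using True wy yk by linarith
      have ratio: "(1 - \<epsilon>) * q i \<le> q (Suc i)" if "i < m + w" for i
      proof -
        have ik: "i < k" using that mw by simp
        have i1: "real i + 1 \<le> y + w" using that True by linarith
        have "(1 - \<epsilon>) * ((i + 1) * (1 - p)) \<le> (1 - \<epsilon>) * ((y + w) * (1 - p))"
          using eps1 p i1 by (intro mult_left_mono mult_right_mono) auto
        also have "\<dots> \<le> (real k - real i) * p"
        proof -
          have "(1 - \<epsilon>) * (y + w) = y + w - (2 * real w + 1) - (2 * real w + 1) * w / y"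
            using y by (simp add: \<epsilon>_def field_simps)
          also have "\<dots> \<le> y - w - 1" by (simp add: y less_imp_le)
          finally have "(1 - \<epsilon>) * (y + w) * (1 - p) \<le> (y - w - 1) * (1 - p)"
            using p by (intro mult_right_mono) auto
          also have "\<dots> \<le> y * (1 - p) - w * p + p"
          proof -
            have "real w * p \<le> real w * (1 - p)" using p by (intro mult_left_mono) auto
            then show ?thesis using p by (simp add: algebra_simps)
          qed
          also have "\<dots> \<le> (real k - real i) * p"
          proof -
            have "p * (real i + 1) \<le> p * (y + w)" using i1 p by (intro mult_left_mono) auto
            then show ?thesis unfolding y_def by (simp add: algebra_simps)
          qed
          finally show ?thesis by (simp add: mult.assoc)
        qed
        finally have "q i * ((1 - \<epsilon>) * ((i + 1) * (1 - p))) \<le> q i * ((real k - real i) * p)"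
          using q0 by (intro mult_left_mono) auto
        also have "\<dots> = q (Suc i) * ((i + 1) * (1 - p))" using step[OF ik] by (simp add: add.commute)
        finally have "((1 - \<epsilon>) * q i) * ((i + 1) * (1 - p)) \<le> q (Suc i) * ((i + 1) * (1 - p))"
          by (simp add: mult_ac)
        then show ?thesis using p by (subst (asm) mult_le_cancel_right) (auto simp: zero_less_mult_iff)
      qed
      have "(1 - \<epsilon>) ^ i * q m \<le> q (m + i)" if "i \<le> w" for i
        using that
      proof (induction i)
        case (Suc i)
        then have "(1 - \<epsilon>) * ((1 - \<epsilon>) ^ i * q m) \<le> (1 - \<epsilon>) * q (m + i)"
          using eps1 by (intro mult_left_mono) auto
        also have "\<dots> \<le> q (Suc (m + i))" using Suc.prems by (intro ratio) simp
        finally show ?case by (simp add: mult.assoc)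
      qed simp
      moreover have "1 / 2 * q m \<le> (1 - \<epsilon>) ^ i * q m" if "i \<le> w" for i
        using half[OF that] q0 by (intro mult_right_mono)
      ultimately have *: "q (m + i) \<ge> q m / 2" if "i \<le> w" for i
        using that by fastforce
      have "q j \<ge> q m / 2" if "j \<in> {m..m + w}" for j
        using *[of "j - m"] that by auto
      then show ?thesis using mw by (intro exI[of _ "{m..m + w}"]) auto
    next
      case False
      have mw: "w \<le> m" using False wy by linarith
      have ratio: "(1 - \<epsilon>) * q (Suc i) \<le> q i" if i: "m - w \<le> i" "i < m" for i
      proof -
        have ik: "i < k" using i m by simp
        have i1: "y - w \<le> real i" using i False mw by linarith
        have yp: "y \<le> k * (1 - p)" unfolding y_def using p by (intro mult_left_mono) auto
        have "(1 - \<epsilon>) * ((real k - real i) * p) \<le> (1 - \<epsilon>) * ((k - y + w) * p)"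
          using eps1 p i1 by (intro mult_left_mono mult_right_mono) auto
        also have "\<dots> = (1 - \<epsilon>) * (y * (1 - p) + w * p)" by (simp add: y_def algebra_simps)
        also have "\<dots> = y * (1 - p) + w * p - (2 * real w + 1) * (1 - p) - (2 * real w + 1) * w * p / y"
          using y by (simp add: \<epsilon>_def field_simps)
        also have "\<dots> \<le> y * (1 - p) - w * (1 - p)"
        proof -
          have "real w * p \<le> real w * (1 - p)" using p by (intro mult_left_mono) auto
          moreover have "(2 * real w + 1) * w * p / y \<ge> 0" using p y by simp
          ultimately show ?thesis using p by (simp add: algebra_simps)
        qed
        also have "\<dots> \<le> (i + 1) * (1 - p)"
        proof -
          have "(y - w) * (1 - p) \<le> (i + 1) * (1 - p)" using i1 p by (intro mult_right_mono) auto
          then show ?thesis by (simp add: algebra_simps)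
        qed
        finally have "q (Suc i) * ((1 - \<epsilon>) * ((real k - real i) * p)) \<le> q (Suc i) * ((i + 1) * (1 - p))"
          using q0 by (intro mult_left_mono) auto
        also have "\<dots> = q i * ((real k - real i) * p)" using step[OF ik] by (simp add: add.commute)
        finally have "((1 - \<epsilon>) * q (Suc i)) * ((real k - real i) * p) \<le> q i * ((real k - real i) * p)"
          by (simp add: mult_ac)
        then show ?thesis using p ik by (subst (asm) mult_le_cancel_right) (auto simp: zero_less_mult_iff)
      qed
      have "(1 - \<epsilon>) ^ i * q m \<le> q (m - i)" if "i \<le> w" for i
        using that
      proof (induction i)
        case (Suc i)
        then have "(1 - \<epsilon>) * ((1 - \<epsilon>) ^ i * q m) \<le> (1 - \<epsilon>) * q (m - i)"
          using eps1 by (intro mult_left_mono) auto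
        also have "m - i = Suc (m - Suc i)" using Suc.prems mw by simp
        also have "(1 - \<epsilon>) * q (Suc (m - Suc i)) \<le> q (m - Suc i)"
          using Suc.prems mw by (intro ratio) auto
        finally show ?case by (simp add: mult.assoc)
      qed simp
      moreover have "1 / 2 * q m \<le> (1 - \<epsilon>) ^ i * q m" if "i \<le> w" for i
        using half[OF that] q0 by (intro mult_right_mono)
      ultimately have *: "q (m - i) \<ge> q m / 2" if "i \<le> w" for i
        using that by fastforce
      have "q j \<ge> q m / 2" if "j \<in> {m - w..m}" for j
        using *[of "m - j"] that mw by auto
      then show ?thesis using mw m by (intro exI[of _ "{m - w..m}"]) auto
    qed
    then obtain J where J: "J \<subseteq> {..k}" "card J = w + 1" "\<And>j. j \<in> J \<Longrightarrow> q j \<ge> q m / 2"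
      by auto
    \<comment> \<open>More than \<open>sqrt y / 3\<close> terms of size at least
      \<open>q m / 2\<close> have sum at most 1; hence the constant 6.\<close>
    have "(real w + 1) * (q m / 2) = (\<Sum>j\<in>J. q m / 2)" using J(2) by simp
    also have "\<dots> \<le> (\<Sum>j\<in>J. q j)" using J(3) by (rule sum_mono)
    also have "\<dots> \<le> (\<Sum>j\<le>k. q j)" using J(1) q0 by (intro sum_mono2) auto
    finally have "(real w + 1) * (q m / 2) \<le> 1" using sumq by simp
    moreover have "(sqrt y / 3) * (q m / 2) \<le> (real w + 1) * (q m / 2)"
      using w_ge q0[of m] by (intro mult_right_mono) auto
    ultimately have "q m \<le> 6 / sqrt y" using y by (simp add: field_simps)
    then show ?thesis by (simp add: q_def y_def)
  qed
qed

text \<open>Each \<open>F\<close> has probability at most \<open>6 / sqrt (k * p)\<close> divided by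
  the binomial coefficient of its size, where \<open>k = card I\<close>. For positive weights the
  sets of equal weight form an antichain, over which the reciprocal binomials sum to at most
  1.\<close>

lemma littlewood_offord_pos:
  fixes x :: "'a \<Rightarrow> real" and p :: real
  assumes "finite I" "\<And>i. i \<in> I \<Longrightarrow> x i > 0" "I \<noteq> {}" and p: "0 < p" "p \<le> 1 / 2"
  shows "EE p I (\<lambda>F. ind (sum x F = b)) \<le> 6 / sqrt (card I * p)"
proof -
  let ?k = "card I"
  have k: "?k > 0" using assms by (simp add: card_gt_0_iff)
  have "EE p I (\<lambda>F. ind (sum x F = b)) = (\<Sum>F | F \<subseteq> I \<and> sum x F = b. p ^ card F * (1 - p) ^ card (I - F))"
    unfolding EE_def using assms(1) by (intro sum.mono_neutral_cong_right) auto
  also have "\<dots> \<le> (\<Sum>F | F \<subseteq> I \<and> sum x F = b. 6 / sqrt (?k * p) * (1 / real (?k choose card F)))"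
  proof (rule sum_mono)
    fix F assume "F \<in> {F. F \<subseteq> I \<and> sum x F = b}"
    then have F: "F \<subseteq> I" by simp
    then have le: "card F \<le> ?k" using assms(1) by (simp add: card_mono)
    have "card (I - F) = ?k - card F" using F assms(1) by (simp add: card_Diff_subset finite_subset)
    then have "p ^ card F * (1 - p) ^ card (I - F) * real (?k choose card F) \<le> 6 / sqrt (?k * p)"
      using binomial_term_le[OF p le k] by (simp add: mult_ac)
    moreover have "real (?k choose card F) > 0" using le by simp
    ultimately have "p ^ card F * (1 - p) ^ card (I - F) \<le> 6 / sqrt (?k * p) / real (?k choose card F)"
      by (subst pos_le_divide_eq)
    then show "p ^ card F * (1 - p) ^ card (I - F) \<le> 6 / sqrt (?k * p) * (1 / real (?k choose card F))"
      by simp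
  qed
  also have "\<dots> = 6 / sqrt (?k * p) * (\<Sum>F | F \<subseteq> I \<and> sum x F = b. 1 / real (?k choose card F))"
    by (rule sum_distrib_left[symmetric])
  also have "\<dots> \<le> 6 / sqrt (?k * p) * 1"
    using p by (intro mult_left_mono sum_inverse_binomial_level_le_1) (use assms in auto)
  finally show ?thesis by simp
qed

text \<open>At least half of the nonzero coefficients have the same sign; fixing the random set on
  the remaining indices only shifts \<open>b\<close>. The constant 9 absorbs
  \<open>6 * sqrt 2\<close>.\<close>

lemma littlewood_offord:
  fixes x :: "'a \<Rightarrow> real" and p t :: real
  assumes "finite I" "t \<le> card {i \<in> I. x i \<noteq> 0}" "t > 0" and p: "0 < p" "p \<le> 1 / 2"
  shows "EE p I (\<lambda>F. ind (sum x F = b)) \<le> 9 / sqrt (t * p)"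
proof -
  have "\<exists>P. P \<subseteq> I \<and> t / 2 \<le> card P \<and> ((\<forall>i\<in>P. x i > 0) \<or> (\<forall>i\<in>P. x i < 0))"
  proof -
    have "{i \<in> I. x i \<noteq> 0} = {i \<in> I. x i > 0} \<union> {i \<in> I. x i < 0}" by auto
    then have "card {i \<in> I. x i \<noteq> 0} \<le> card {i \<in> I. x i > 0} + card {i \<in> I. x i < 0}"
      by (metis card_Un_le)
    then have "t / 2 \<le> card {i \<in> I. x i > 0} \<or> t / 2 \<le> card {i \<in> I. x i < 0}"
      using assms(2) by linarith
    then show ?thesis by (elim disjE) (force intro: exI[of _ "{i \<in> I. x i > 0}"] exI[of _ "{i \<in> I. x i < 0}"])+
  qed
  then obtain P where P: "P \<subseteq> I" "t / 2 \<le> card P" "(\<forall>i\<in>P. x i > 0) \<or> (\<forall>i\<in>P. x i < 0)"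
    by blast
  have finP: "finite P" using P(1) assms(1) finite_subset by blast
  have neP: "P \<noteq> {}" using P(2) assms(3) by auto
  have main: "EE p P (\<lambda>F. ind (sum x F = c)) \<le> 9 / sqrt (t * p)" for c
  proof -
    have "EE p P (\<lambda>F. ind (sum x F = c)) \<le> 6 / sqrt (card P * p)"
      using P(3)
    proof
      assume "\<forall>i\<in>P. x i > 0"
      then show ?thesis using littlewood_offord_pos[OF finP _ neP p] by auto
    next
      assume neg: "\<forall>i\<in>P. x i < 0"
      have "EE p P (\<lambda>F. ind (sum x F = c)) = EE p P (\<lambda>F. ind (sum (\<lambda>i. - x i) F = - c))"
        by (simp add: sum_negf)
      then show ?thesis using littlewood_offord_pos[OF finP _ neP p, of "\<lambda>i. - x i"] neg by auto
    qed
    also have "\<dots> \<le> 6 / sqrt (t / 2 * p)"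
      using P(2) p assms(3) by (intro divide_left_mono real_sqrt_le_mono mult_right_mono mult_pos_pos) auto
    also have "sqrt (t / 2 * p) = sqrt (t * p) / sqrt 2"
      by (simp flip: real_sqrt_divide)
    also have "6 / (sqrt (t * p) / sqrt 2) = 6 * sqrt 2 / sqrt (t * p)" by simp
    also have "\<dots> \<le> 9 / sqrt (t * p)"
    proof -
      have "sqrt 2 \<le> 3 / 2" by (rule real_le_lsqrt) (auto simp: power2_eq_square)
      then show ?thesis using p assms(3) by (intro divide_right_mono) auto
    qed
    finally show ?thesis .
  qed
  have "EE p I (\<lambda>F. ind (sum x F = b)) = EE p ((I - P) \<union> P) (\<lambda>F. ind (sum x F = b))"
    using P(1) by (simp add: Un_absorb2)
  also have "\<dots> = EE p (I - P) (\<lambda>F. EE p P (\<lambda>G. ind (sum x (F \<union> G) = b)))"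
    using finP assms(1) by (intro EE_union) auto
  also have "\<dots> = EE p (I - P) (\<lambda>F. EE p P (\<lambda>G. ind (sum x G = b - sum x F)))"
  proof (intro EE_cong)
    fix F G assume "F \<subseteq> I - P" "G \<subseteq> P"
    then have "sum x (F \<union> G) = sum x F + sum x G"
      using finP assms(1) by (intro sum.union_disjoint) (auto intro: finite_subset)
    then show "ind (sum x (F \<union> G) = b) = ind (sum x G = b - sum x F)" by auto
  qed
  also have "\<dots> \<le> EE p (I - P) (\<lambda>F. 9 / sqrt (t * p))"
    using p by (intro EE_mono main) auto
  finally show ?thesis using assms(1) by simp
qed

text \<open>Decoupling: split \<open>F\<close> into \<open>G \<subseteq> J\<close> and \<open>F \<subseteq> U - J\<close>. By the Cauchy--Schwarz inequality it is
  enough that the form rarely vanishes for two independent copies of \<open>F\<close> with the same \<open>G\<close>, and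
  the difference of the two values is affine in \<open>G\<close>.\<close>

lemma quadratic_littlewood_offord:
  fixes M :: "'a \<Rightarrow> 'a \<Rightarrow> real" and p t :: real
  assumes fin: "finite U" and J: "J \<subseteq> U" "J \<noteq> {}" and p: "0 < p" "p \<le> 1 / 2" and t: "t > 0"
    and sym: "\<And>i j. i \<in> U \<Longrightarrow> j \<in> U \<Longrightarrow> M i j = M j i"
    and nz: "\<And>j. j \<in> J \<Longrightarrow> t \<le> card {i \<in> U - J. M i j \<noteq> 0}"
  shows "(EE p U (\<lambda>F. ind ((\<Sum>i\<in>F. \<Sum>j\<in>F. M i j) = 0)))\<^sup>2
    \<le> 18 / sqrt (t * p) + 9 / sqrt (card J / 2 * p)"
proof -
  define Q where "Q F = (\<Sum>i\<in>F. \<Sum>j\<in>F. M i j)" for F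
  define W where "W = U - J"
  define c where "c F F' j = 2 * ((\<Sum>i\<in>F. M i j) - (\<Sum>i\<in>F'. M i j))" for F F' j
  have finJ: "finite J" and finW: "finite W" using fin J(1) by (auto simp: W_def intro: finite_subset)
  have cJ: "card J > 0" using finJ J(2) by (simp add: card_gt_0_iff)
  have p01: "0 \<le> p" "p \<le> 1" using p by auto
  let ?L = "9 / sqrt (card J / 2 * p)"
  have Qun: "Q (G \<union> F) = Q G + Q F + 2 * (\<Sum>j\<in>G. \<Sum>i\<in>F. M i j)" if G: "G \<subseteq> J" and F: "F \<subseteq> W" for F G
  proof -
    have fGF: "finite G" "finite F" "G \<inter> F = {}"
      using G F finJ finW by (auto simp: W_def intro: finite_subset)
    have "(\<Sum>i\<in>F. \<Sum>j\<in>G. M i j) = (\<Sum>j\<in>G. \<Sum>i\<in>F. M i j)" by (rule sum.swap)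
    moreover have "(\<Sum>i\<in>G. \<Sum>j\<in>F. M i j) = (\<Sum>j\<in>G. \<Sum>i\<in>F. M i j)"
      using G F J(1) by (intro sum.cong sym) (auto simp: W_def)
    ultimately show ?thesis
      unfolding Q_def by (simp add: sum.union_disjoint[OF fGF] sum.distrib)
  qed
  have inner: "EE p J (\<lambda>G. ind (Q (G \<union> F) = 0) * ind (Q (G \<union> F') = 0))
      \<le> ?L + 2 / card J * (\<Sum>j\<in>J. ind ((\<Sum>i\<in>F. M i j) = (\<Sum>i\<in>F'. M i j)))"
    if F: "F \<subseteq> W" "F' \<subseteq> W" for F F'
  proof -
    have "EE p J (\<lambda>G. ind (Q (G \<union> F) = 0) * ind (Q (G \<union> F') = 0))
      \<le> EE p J (\<lambda>G. ind (sum (c F F') G = Q F' - Q F))"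
    proof (rule EE_mono[OF p01])
      fix G assume G: "G \<subseteq> J"
      have "sum (c F F') G = 2 * (\<Sum>j\<in>G. \<Sum>i\<in>F. M i j) - 2 * (\<Sum>j\<in>G. \<Sum>i\<in>F'. M i j)"
        unfolding c_def by (simp add: sum_subtractf sum_distrib_left right_diff_distrib)
      then have "sum (c F F') G = Q F' - Q F" if "Q (G \<union> F) = 0" "Q (G \<union> F') = 0"
        using that Qun[OF G F(1)] Qun[OF G F(2)] by simp
      then show "ind (Q (G \<union> F) = 0) * ind (Q (G \<union> F') = 0) \<le> ind (sum (c F F') G = Q F' - Q F)"
        by auto
    qed
    \<comment> \<open>Either at least half of the coefficients \<open>c F F' j\<close> are nonzero,
      and the linear inequality in \<open>G\<close> gives \<open>?L\<close>; or at least half of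
      them vanish, and then the second summand is at least 1.\<close>
    also have "\<dots> \<le> ?L + 2 / card J * (\<Sum>j\<in>J. ind (c F F' j = 0))"
    proof (cases "card J / 2 \<le> card {j \<in> J. c F F' j \<noteq> 0}")
      case True
      have "0 \<le> 2 / card J * (\<Sum>j\<in>J. ind (c F F' j = 0))"
        by (intro mult_nonneg_nonneg sum_nonneg) auto
      then show ?thesis
        using littlewood_offord[OF finJ True _ p, of "Q F' - Q F"] cJ by linarith
    next
      case False
      have "J = {j \<in> J. c F F' j \<noteq> 0} \<union> {j \<in> J. c F F' j = 0}" by auto
      then have "card J \<le> card {j \<in> J. c F F' j \<noteq> 0} + card {j \<in> J. c F F' j = 0}"
        by (metis card_Un_le)
      then have "card J / 2 \<le> card {j \<in> J. c F F' j = 0}" using False by linarith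
      also have "real (card {j \<in> J. c F F' j = 0}) = (\<Sum>j\<in>J. ind (c F F' j = 0))"
        using finJ by (simp add: Int_def)
      finally have "1 \<le> 2 / card J * (\<Sum>j\<in>J. ind (c F F' j = 0))"
        using cJ by (simp add: field_simps)
      moreover have "EE p J (\<lambda>G. ind (sum (c F F') G = Q F' - Q F)) \<le> EE p J (\<lambda>_. 1)"
        by (rule EE_mono[OF p01]) auto
      moreover have "0 \<le> ?L" using p by simp
      ultimately show ?thesis using finJ by (simp only: EE_const)
    qed
    finally show ?thesis by (simp add: c_def)
  qed
  \<comment> \<open>\<open>b\<close> will be the value of the same sum at the independent copy
    \<open>F'\<close>.\<close>
  have linear: "EE p W (\<lambda>F. ind ((\<Sum>i\<in>F. M i j) = b)) \<le> 9 / sqrt (t * p)" if "j \<in> J" for j b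
    using littlewood_offord[OF finW _ t p, of "\<lambda>i. M i j" b] nz[OF that] by (simp add: W_def)
  have "EE p U (\<lambda>F. ind (Q F = 0)) = EE p (J \<union> W) (\<lambda>F. ind (Q F = 0))"
    using J(1) by (simp add: W_def Un_absorb1)
  also have "\<dots> = EE p J (\<lambda>G. EE p W (\<lambda>F. ind (Q (G \<union> F) = 0)))"
    by (rule EE_union[OF finJ finW]) (auto simp: W_def)
  finally have "(EE p U (\<lambda>F. ind (Q F = 0)))\<^sup>2 \<le> EE p J (\<lambda>G. (EE p W (\<lambda>F. ind (Q (G \<union> F) = 0)))\<^sup>2)"
    using EE_square_le[OF finJ p01] by simp
  also have "\<dots> = EE p J (\<lambda>G. EE p W (\<lambda>F. EE p W (\<lambda>F'. ind (Q (G \<union> F) = 0) * ind (Q (G \<union> F') = 0))))"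
    by (simp only: EE_cmult EE_multc power2_eq_square)
  also have "\<dots> = EE p W (\<lambda>F. EE p W (\<lambda>F'. EE p J (\<lambda>G. ind (Q (G \<union> F) = 0) * ind (Q (G \<union> F') = 0))))"
    by (subst EE_swap, rule EE_cong, rule EE_swap)
  also have "\<dots> \<le> EE p W (\<lambda>F. EE p W (\<lambda>F'. ?L + 2 / card J * (\<Sum>j\<in>J. ind ((\<Sum>i\<in>F. M i j) = (\<Sum>i\<in>F'. M i j)))))"
    by (intro EE_mono[OF p01] inner)
  also have "\<dots> = ?L + 2 / card J * (\<Sum>j\<in>J. EE p W (\<lambda>F'. EE p W (\<lambda>F. ind ((\<Sum>i\<in>F. M i j) = (\<Sum>i\<in>F'. M i j)))))"
    by (subst EE_swap) (simp only: EE_add EE_cmult EE_sum EE_const[OF finW])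
  also have "\<dots> \<le> ?L + 2 / card J * (\<Sum>j\<in>J. EE p W (\<lambda>F'. 9 / sqrt (t * p)))"
    by (intro add_left_mono mult_left_mono sum_mono EE_mono[OF p01] linear) auto
  also have "\<dots> = 18 / sqrt (t * p) + ?L"
    using cJ finW by simp
  finally show ?thesis unfolding Q_def .
qed

section \<open>Linear systems\<close>

text \<open>Row rank is at most the number of columns. Gaussian elimination picks the rows: a column
  with a pivot contributes one row to \<open>I\<close>, a zero column none.\<close>

lemma spanning_rows_exist:
  fixes r :: "'b \<Rightarrow> 'a \<Rightarrow> real"
  assumes "finite S"
  shows "\<exists>I\<subseteq>R. finite I \<and> card I \<le> card S \<and>
    (\<forall>x. (\<forall>u\<in>I. (\<Sum>v\<in>S. r u v * x v) = 0) \<longrightarrow> (\<forall>u\<in>R. (\<Sum>v\<in>S. r u v * x v) = 0))"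
  using assms
proof (induction S arbitrary: r rule: finite_induct)
  case (insert a S)
  show ?case
  proof (cases "\<forall>u\<in>R. r u a = 0")
    case True
    obtain I where I: "I \<subseteq> R" "finite I" "card I \<le> card S"
      "\<forall>x. (\<forall>u\<in>I. (\<Sum>v\<in>S. r u v * x v) = 0) \<longrightarrow> (\<forall>u\<in>R. (\<Sum>v\<in>S. r u v * x v) = 0)"
      using insert.IH by blast
    show ?thesis
      using I True insert.hyps by (intro exI[of _ I]) (auto simp: subset_iff)
  next
    case False
    then obtain w where w: "w \<in> R" "r w a \<noteq> 0" by blast
    define r' where "r' u v = r u v - r u a / r w a * r w v" for u v
    obtain I where I: "I \<subseteq> R" "finite I" "card I \<le> card S"
      "\<forall>x. (\<forall>u\<in>I. (\<Sum>v\<in>S. r' u v * x v) = 0) \<longrightarrow> (\<forall>u\<in>R. (\<Sum>v\<in>S. r' u v * x v) = 0)"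
      using insert.IH[of r'] by blast
    have *: "(\<Sum>v\<in>S. r' u v * x v) = (\<Sum>v\<in>insert a S. r u v * x v)"
      if "(\<Sum>v\<in>insert a S. r w v * x v) = 0" for u x
    proof -
      have "(\<Sum>v\<in>S. r' u v * x v) = (\<Sum>v\<in>S. r u v * x v) - r u a / r w a * (\<Sum>v\<in>S. r w v * x v)"
        unfolding r'_def by (simp add: left_diff_distrib sum_subtractf sum_distrib_left mult.assoc)
      also have "(\<Sum>v\<in>S. r w v * x v) = - r w a * x a"
        using that insert.hyps by simp
      finally show ?thesis using w(2) insert.hyps by simp
    qed
    have "(\<Sum>v\<in>insert a S. r u v * x v) = 0"
      if "\<forall>u\<in>insert w I. (\<Sum>v\<in>insert a S. r u v * x v) = 0" "u \<in> R" for x u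
    proof -
      have **: "(\<Sum>v\<in>S. r' u v * x v) = (\<Sum>v\<in>insert a S. r u v * x v)" for u
        using that(1) by (intro *) blast
      have "\<forall>u\<in>I. (\<Sum>v\<in>S. r' u v * x v) = 0"
        unfolding ** using that(1) by blast
      then have "(\<Sum>v\<in>S. r' u v * x v) = 0" using I(4) that(2) by blast
      then show ?thesis unfolding ** .
    qed
    moreover have "card (insert w I) \<le> card (insert a S)"
      using I(2,3) insert.hyps by (simp add: card_insert_if)
    ultimately show ?thesis using I(1,2) w(1) by (intro exI[of _ "insert w I"]) blast
  qed
qed (auto intro: exI[of _ "{}"])

text \<open>Elimination of one column carries both alternatives along. For a symmetric matrix the
  obstruction \<open>y\<close> is a kernel vector, so that absence of kernel vectors yields the
  columns of an inverse.\<close>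

lemma fredholm_alternative:
  fixes m :: "'b \<Rightarrow> 'a \<Rightarrow> real"
  assumes "finite S" "finite R"
  shows "(\<exists>x. \<forall>i\<in>R. (\<Sum>j\<in>S. m i j * x j) = b i) \<or>
    (\<exists>y. (\<forall>j\<in>S. (\<Sum>i\<in>R. y i * m i j) = 0) \<and> (\<Sum>i\<in>R. y i * b i) \<noteq> 0)"
  using assms
proof (induction S arbitrary: R m b rule: finite_induct)
  case empty
  show ?case
  proof (cases "\<forall>i\<in>R. b i = 0")
    case False
    then obtain i where i: "i \<in> R" "b i \<noteq> 0" by blast
    have "(\<Sum>k\<in>R. ind (k = i) * b k) = b i"
      using i(1) empty by (simp add: of_bool_def if_distrib[of "\<lambda>x. x * _"] sum.delta' cong: if_cong)
    then show ?thesis using i(2) by (intro disjI2 exI[of _ "\<lambda>k. ind (k = i)"]) auto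
  qed auto
next
  case (insert a S)
  show ?case
  proof (cases "\<forall>i\<in>R. m i a = 0")
    case True
    then show ?thesis using insert.IH[OF insert.prems, of m b] insert.hyps by auto
  next
    case False
    then obtain w where w: "w \<in> R" "m w a \<noteq> 0" by blast
    define m' where "m' i j = m i j - m i a / m w a * m w j" for i j
    define b' where "b' i = b i - m i a / m w a * b w" for i
    have fR: "finite (R - {w})" using insert.prems by simp
    consider x where "\<forall>i\<in>R - {w}. (\<Sum>j\<in>S. m' i j * x j) = b' i"
      | y where "\<forall>j\<in>S. (\<Sum>i\<in>R - {w}. y i * m' i j) = 0" "(\<Sum>i\<in>R - {w}. y i * b' i) \<noteq> 0"
      using insert.IH[OF fR, of m' b'] by blast
    then show ?thesis
    proof cases
      case 1
      define x' where "x' = x(a := (b w - (\<Sum>j\<in>S. m w j * x j)) / m w a)"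
      have xs: "(\<Sum>j\<in>insert a S. m i j * x' j) = m i a * x' a + (\<Sum>j\<in>S. m i j * x j)" for i
      proof -
        have "(\<Sum>j\<in>S. m i j * x' j) = (\<Sum>j\<in>S. m i j * x j)"
          using insert.hyps by (intro sum.cong) (auto simp: x'_def)
        then show ?thesis using insert.hyps by simp
      qed
      have "(\<Sum>j\<in>insert a S. m i j * x' j) = b i" if "i \<in> R" for i
      proof (cases "i = w")
        case True
        then show ?thesis unfolding xs using w(2) by (simp add: x'_def)
      next
        case False
        then have "(\<Sum>j\<in>S. m' i j * x j) = b' i" using 1 that by simp
        then have "(\<Sum>j\<in>S. m i j * x j) - m i a / m w a * (\<Sum>j\<in>S. m w j * x j) = b i - m i a / m w a * b w"
          unfolding m'_def b'_def by (simp add: left_diff_distrib sum_subtractf sum_distrib_left mult.assoc)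
        then show ?thesis unfolding xs using w(2) by (simp add: x'_def field_simps)
      qed
      then show ?thesis by blast
    next
      case 2
      \<comment> \<open>The weight of the pivot row is chosen so that the combination of rows
        vanishes in column \<open>a\<close>.\<close>
      define z where "z = - (\<Sum>i\<in>R - {w}. y i * m i a) / m w a"
      define y' where "y' = y(w := z)"
      have "(\<Sum>i\<in>R. y' i * f i) = z * f w + (\<Sum>i\<in>R - {w}. y i * f i)" for f
        using insert.prems w(1) by (subst sum.remove[of R w]) (auto simp: y'_def)
      then have ys: "(\<Sum>i\<in>R. y' i * f i) = (\<Sum>i\<in>R - {w}. y i * (f i - m i a / m w a * f w))" for f
        unfolding z_def
        by (simp add: right_diff_distrib sum_subtractf sum_distrib_right sum_divide_distrib sum_negf mult.assoc)
      have "\<forall>j\<in>insert a S. (\<Sum>i\<in>R. y' i * m i j) = 0"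
        unfolding ys using 2(1) w(2) by (auto simp: m'_def)
      moreover have "(\<Sum>i\<in>R. y' i * b i) \<noteq> 0"
        unfolding ys using 2(2) by (simp add: b'_def)
      ultimately show ?thesis by blast
    qed
  qed
qed

section \<open>Kernel vectors of small support\<close>

text \<open>The analogue of \<open>vertex_pairs\<close> for arbitrary vertex sets, since vertices
  are deleted and subsets \<open>S\<close> are singled out below.\<close>

definition pairs :: "'a set \<Rightarrow> 'a set set" where
  "pairs V = {e. e \<subseteq> V \<and> card e = 2}"

text \<open>\<open>sum x (nbrs E u V)\<close> is the entry at \<open>u\<close> of the adjacency
  matrix times \<open>x\<close>; kernel equations are written in this form up to
  \<open>rank_adjacency_matrix\<close>.\<close>

definition nbrs :: "'a set set \<Rightarrow> 'a \<Rightarrow> 'a set \<Rightarrow> 'a set" where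
  "nbrs E u S = {w \<in> S. {u, w} \<in> E}"

definition star :: "'a \<Rightarrow> 'a set \<Rightarrow> 'a set set" where
  "star u S = (\<lambda>w. {u, w}) ` S"

lemma finite_pairs [simp]: "finite V \<Longrightarrow> finite (pairs V)"
  unfolding pairs_def by (rule finite_subset[of _ "Pow V"]) auto

lemma card_pairs: "finite V \<Longrightarrow> card (pairs V) = card V choose 2"
  unfolding pairs_def by (rule n_subsets)

lemma pairs_mono: "S \<subseteq> V \<Longrightarrow> pairs S \<subseteq> pairs V"
  by (auto simp: pairs_def)

lemma pair_in_pairs_iff: "{u, w} \<in> pairs V \<longleftrightarrow> u \<in> V \<and> w \<in> V \<and> u \<noteq> w"
  by (auto simp: pairs_def card_insert_if)

lemma inj_on_pair: "inj_on (\<lambda>w. {u, w}) S"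
  by (auto simp: inj_on_def doubleton_eq_iff)

lemma star_subset_pairs: "u \<in> V \<Longrightarrow> S \<subseteq> V \<Longrightarrow> u \<notin> S \<Longrightarrow> star u S \<subseteq> pairs V"
  by (auto simp: star_def pair_in_pairs_iff)

lemma finite_nbrs [simp]: "finite S \<Longrightarrow> finite (nbrs E u S)"
  by (simp add: nbrs_def)

lemma nbrs_subset: "nbrs E u S \<subseteq> S"
  by (auto simp: nbrs_def)

lemma nbrs_Int_star: "nbrs (E \<inter> star u S) u S = nbrs E u S"
  by (auto simp: nbrs_def star_def)

lemma EE_star: "EE p (star u S) (\<lambda>G. f (nbrs G u S)) = EE p S f"
proof -
  have "nbrs ((\<lambda>w. {u, w}) ` F) u S = F" if "F \<subseteq> S" for F
    using that by (auto simp: nbrs_def doubleton_eq_iff)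
  then show ?thesis
    unfolding star_def by (subst EE_reindex[OF inj_on_pair]) (auto intro: EE_cong)
qed

lemma star_disjoint: "u \<noteq> w \<Longrightarrow> u \<notin> S \<Longrightarrow> w \<notin> S \<Longrightarrow> star u S \<inter> star w S = {}"
  by (auto simp: star_def doubleton_eq_iff)

lemma EE_stars:
  assumes "finite U" "finite S" "U \<inter> S = {}"
  shows "EE p (\<Union>u\<in>U. star u S) (\<lambda>G. \<Prod>u\<in>U. h u (nbrs G u S)) = (\<Prod>u\<in>U. EE p S (h u))"
proof -
  have "EE p (\<Union>u\<in>U. star u S) (\<lambda>G. \<Prod>u\<in>U. h u (nbrs (G \<inter> star u S) u S))
    = (\<Prod>u\<in>U. EE p (star u S) (\<lambda>G. h u (nbrs G u S)))"
    using assms star_disjoint by (intro EE_prod) (auto simp: star_def)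
  then show ?thesis by (simp add: nbrs_Int_star EE_star)
qed

text \<open>The pairs inside \<open>S\<close> and the stars from distinct vertices of
  \<open>U\<close> to \<open>S\<close> are disjoint sets of potential edges, hence independent;
  pairs of vertices outside \<open>S\<close> do not affect the integrand and are summed out.\<close>

lemma EE_pairs_stars:
  assumes "finite V" "S \<subseteq> V" "U \<subseteq> V" "U \<inter> S = {}"
  shows "EE p (pairs V) (\<lambda>E. k (E \<inter> pairs S) * (\<Prod>u\<in>U. h u (nbrs E u S)))
    = EE p (pairs S) k * (\<Prod>u\<in>U. EE p S (h u))"
proof -
  let ?R = "\<Union>u\<in>U. star u S"
  have fin: "finite S" "finite U" using assms(1-3) by (auto intro: finite_subset)
  have sub: "pairs S \<union> ?R \<subseteq> pairs V"
  proof (intro Un_least UN_least)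
    show "pairs S \<subseteq> pairs V" using assms(2) by (rule pairs_mono)
    show "star u S \<subseteq> pairs V" if "u \<in> U" for u
      using that assms by (intro star_subset_pairs) auto
  qed
  have disj: "pairs S \<inter> ?R = {}"
    using assms(4) by (auto simp: star_def pair_in_pairs_iff)
  have finR: "finite ?R" using fin by (auto simp: star_def)
  have nb: "nbrs (E \<inter> X) u S = nbrs E u S" if "u \<in> U" "?R \<subseteq> X" for E u X
    using that by (auto simp: nbrs_def star_def)
  have "EE p (pairs V) (\<lambda>E. k (E \<inter> pairs S) * (\<Prod>u\<in>U. h u (nbrs E u S)))
    = EE p (pairs S \<union> ?R) (\<lambda>E. k (E \<inter> pairs S) * (\<Prod>u\<in>U. h u (nbrs E u S)))"
  proof (intro EE_marginal arg_cong2[where f = "(*)"] prod.cong refl)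
    show "finite (pairs V)" using assms(1) by simp
    fix E u assume "u \<in> U"
    then show "h u (nbrs E u S) = h u (nbrs (E \<inter> (pairs S \<union> ?R)) u S)" by (subst nb) auto
  next
    fix E
    have "E \<inter> (pairs S \<union> ?R) \<inter> pairs S = E \<inter> pairs S" by blast
    then show "k (E \<inter> pairs S) = k (E \<inter> (pairs S \<union> ?R) \<inter> pairs S)" by simp
  qed (rule sub)
  also have "\<dots> = EE p (pairs S) (\<lambda>F. EE p ?R (\<lambda>G. k ((F \<union> G) \<inter> pairs S) * (\<Prod>u\<in>U. h u (nbrs (F \<union> G) u S))))"
    by (rule EE_union) (use fin finR disj in auto)
  also have "\<dots> = EE p (pairs S) (\<lambda>F. EE p ?R (\<lambda>G. k F * (\<Prod>u\<in>U. h u (nbrs G u S))))"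
  proof (intro EE_cong arg_cong2[where f = "(*)"] prod.cong refl)
    fix F G assume F: "F \<subseteq> pairs S" and G: "G \<subseteq> ?R"
    then have "(F \<union> G) \<inter> pairs S = F" using disj by auto
    then show "k ((F \<union> G) \<inter> pairs S) = k F" by simp
    fix u assume u: "u \<in> U"
    have "(F \<union> G) \<inter> ?R = G" using F G disj by auto
    then have "nbrs (F \<union> G) u S = nbrs G u S" using nb[OF u subset_refl, of "F \<union> G"] by simp
    then show "h u (nbrs (F \<union> G) u S) = h u (nbrs G u S)" by simp
  qed
  also have "\<dots> = EE p (pairs S) k * (\<Prod>u\<in>U. EE p S (h u))"
    using fin assms(4) by (simp add: EE_cmult EE_multc EE_stars)
  finally show ?thesis .
qed

definition nonisolated :: "'a set set \<Rightarrow> 'a set \<Rightarrow> 'a set" where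
  "nonisolated E V = {v \<in> V. \<exists>u\<in>V. {u, v} \<in> E}"

text \<open>The support of a kernel vector is \<open>sealed\<close>: a vertex with exactly one neighbour \<open>w\<close> in it
  forces the entry at \<open>w\<close> to vanish. The row of \<open>j\<close> is exempt, so that this also covers the columns
  of the inverse.\<close>

definition sealed :: "'a set set \<Rightarrow> 'a set \<Rightarrow> 'a \<Rightarrow> 'a set \<Rightarrow> bool" where
  "sealed E V j S \<longleftrightarrow> S \<subseteq> nonisolated E V \<and> (\<forall>u\<in>V - S - {j}. card (nbrs E u S) \<noteq> 1)"

lemma EE_power_card_neq_1:
  fixes p x :: real
  assumes "finite S"
  shows "EE p S (\<lambda>F. of_bool (card F \<noteq> 1) * x ^ card F)
    = (1 - p + x * p) ^ card S - x * (card S * p * (1 - p) ^ (card S - 1))"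
proof -
  have "EE p S (\<lambda>F. of_bool (card F \<noteq> 1) * x ^ card F) = EE p S (\<lambda>F. x ^ card F - x * of_bool (card F = 1))"
    by (intro EE_cong) auto
  then show ?thesis
    using EE_power_card[OF assms, of p x] EE_card_eq_1[OF assms, of p]
    by (simp only: EE_diff EE_cmult)
qed

text \<open>Markov's inequality for \<open>x ^ (number of edge ends in S)\<close>: if no vertex of \<open>S\<close> is isolated,
  this number is at least \<open>card S\<close>.\<close>

lemma prob_sealed_le:
  fixes p x :: real
  assumes V: "finite V" "S \<subseteq> V" and j: "j \<in> V - S" and p: "0 \<le> p" "p \<le> 1" and x: "x \<ge> 1"
  defines "s \<equiv> card S"
  shows "EE p (pairs V) (\<lambda>E. ind (sealed E V j S)) \<le>
    (1 / x ^ s) * ((1 - p + x\<^sup>2 * p) ^ (s choose 2) * ((1 - p + x * p) ^ s *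
      ((1 - p + x * p) ^ s - x * (s * p * (1 - p) ^ (s - 1))) ^ (card V - s - 1)))"
proof -
  define U where "U = V - S"
  \<comment> \<open>The condition at \<open>u\<close> is built into the factor, so that the event is
    bounded by a product of independent terms. The row of \<open>j\<close> is exempt and keeps the
    full generating function.\<close>
  define h where "h u F = (if u = j then x ^ card F else of_bool (card F \<noteq> 1) * x ^ card F)" for u and F :: "'a set"
  have fin: "finite S" "finite U" using V by (auto simp: U_def intro: finite_subset)
  have h0: "h u F \<ge> 0" for u F using x by (auto simp: h_def)
  have "ind (sealed E V j S) \<le> (1 / x ^ s) * ((x\<^sup>2) ^ card (E \<inter> pairs S) * (\<Prod>u\<in>U. h u (nbrs E u S)))"
    if E: "E \<subseteq> pairs V" for E
  proof (cases "sealed E V j S")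
    case False
    have "0 \<le> (1 / x ^ s) * ((x\<^sup>2) ^ card (E \<inter> pairs S) * (\<Prod>u\<in>U. h u (nbrs E u S)))"
      using x h0 by (intro mult_nonneg_nonneg prod_nonneg) auto
    then show ?thesis using False by simp
  next
    case True
    have finE: "finite E" using E V(1) finite_subset finite_pairs by blast
    \<comment> \<open>Every vertex of \<open>S\<close> has a neighbour inside \<open>S\<close> or
      outside. Edges inside \<open>S\<close> have two ends in \<open>S\<close>, which is why they
      carry the weight \<open>x^2\<close>.\<close>
    have "S \<subseteq> \<Union> (E \<inter> pairs S) \<union> (\<Union>u\<in>U. nbrs E u S)"
    proof
      fix v assume v: "v \<in> S"
      then have "v \<in> nonisolated E V" using True by (auto simp: sealed_def)
      then obtain u where u: "u \<in> V" "{u, v} \<in> E" unfolding nonisolated_def by blast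
      show "v \<in> \<Union> (E \<inter> pairs S) \<union> (\<Union>u\<in>U. nbrs E u S)"
      proof (cases "u \<in> S")
        case True
        then have "{u, v} \<in> E \<inter> pairs S"
          using u(2) v E pair_in_pairs_iff[of u v S] pair_in_pairs_iff[of u v V] by blast
        then show ?thesis by blast
      next
        case False
        then have "u \<in> U" "v \<in> nbrs E u S" using u v by (auto simp: U_def nbrs_def)
        then show ?thesis by blast
      qed
    qed
    then have "s \<le> card (\<Union> (E \<inter> pairs S) \<union> (\<Union>u\<in>U. nbrs E u S))"
      unfolding s_def using fin finE by (intro card_mono) (auto simp: pairs_def intro: finite_subset)
    also have "\<dots> \<le> card (\<Union> (E \<inter> pairs S)) + card (\<Union>u\<in>U. nbrs E u S)" by (rule card_Un_le)
    also have "card (\<Union> (E \<inter> pairs S)) \<le> (\<Sum>e\<in>E \<inter> pairs S. card e)"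
      using card_UN_le[of "E \<inter> pairs S" id] finE by simp
    also have "(\<Sum>e\<in>E \<inter> pairs S. card e) = 2 * card (E \<inter> pairs S)"
      by (simp add: pairs_def)
    also have "card (\<Union>u\<in>U. nbrs E u S) \<le> (\<Sum>u\<in>U. card (nbrs E u S))"
      using fin by (intro card_UN_le)
    finally have "s \<le> 2 * card (E \<inter> pairs S) + (\<Sum>u\<in>U. card (nbrs E u S))" by simp
    then have "x ^ s \<le> x ^ (2 * card (E \<inter> pairs S) + (\<Sum>u\<in>U. card (nbrs E u S)))"
      using x by (rule power_increasing)
    also have "\<dots> = (x\<^sup>2) ^ card (E \<inter> pairs S) * (\<Prod>u\<in>U. x ^ card (nbrs E u S))"
      by (simp add: power_add power_mult power_sum)
    also have "(\<Prod>u\<in>U. x ^ card (nbrs E u S)) = (\<Prod>u\<in>U. h u (nbrs E u S))"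
      using True by (intro prod.cong) (auto simp: h_def sealed_def U_def)
    finally show ?thesis using x True by (simp add: field_simps)
  qed
  then have "EE p (pairs V) (\<lambda>E. ind (sealed E V j S)) \<le>
    EE p (pairs V) (\<lambda>E. (1 / x ^ s) * ((x\<^sup>2) ^ card (E \<inter> pairs S) * (\<Prod>u\<in>U. h u (nbrs E u S))))"
    by (intro EE_mono p)
  also have "\<dots> = (1 / x ^ s) * (EE p (pairs S) (\<lambda>E. (x\<^sup>2) ^ card E) * (\<Prod>u\<in>U. EE p S (h u)))"
    unfolding EE_cmult by (subst EE_pairs_stars) (use V U_def in auto)
  also have "(\<Prod>u\<in>U. EE p S (h u)) = EE p S (h j) * (\<Prod>u\<in>U - {j}. EE p S (h u))"
    using fin j by (intro prod.remove) (auto simp: U_def)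
  also have "(\<Prod>u\<in>U - {j}. EE p S (h u)) = (\<Prod>u\<in>U - {j}. EE p S (\<lambda>F. of_bool (card F \<noteq> 1) * x ^ card F))"
    by (intro prod.cong EE_cong refl) (auto simp: h_def)
  also have "\<dots> = EE p S (\<lambda>F. of_bool (card F \<noteq> 1) * x ^ card F) ^ (card V - s - 1)"
  proof -
    have "card (U - {j}) = card V - s - 1"
      using j V fin by (simp add: U_def s_def card_Diff_subset)
    then show ?thesis by simp
  qed
  also have "EE p S (h j) = (1 - p + x * p) ^ s"
    unfolding h_def s_def using EE_power_card[OF fin(1), of p x] by simp
  finally show ?thesis
    by (simp only: EE_power_card_neq_1[OF fin(1)] EE_power_card[OF finite_pairs[OF fin(1)]]
      card_pairs[OF fin(1)] s_def)
qed

section \<open>Sealed sets: bounds for one set and the union bound\<close>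

text \<open>Follows from \<open>s ^ s \<le> exp s * fact s\<close>, which keeps a single term of the
  exponential series.\<close>

lemma binomial_le_exp_power:
  assumes "s \<ge> 1"
  shows "real (N choose s) \<le> (exp 1 * N / s) ^ s"
proof -
  have "(\<Sum>i\<in>{s}. inverse (fact i) * real s ^ i) \<le> (\<Sum>i. inverse (fact i) * real s ^ i)"
    using summable_exp[of "real s"] by (intro sum_le_suminf) auto
  then have *: "real s ^ s \<le> exp s * fact s"
    by (simp add: exp_def field_simps)
  have "real (N choose s) * fact s \<le> real N ^ s"
    using binomial_fact_pow[of N s] by (metis of_nat_fact of_nat_le_iff of_nat_mult of_nat_power)
  then have **: "(real (N choose s) * fact s) * exp s \<le> real N ^ s * exp s"
    by (intro mult_right_mono) auto
  have "real (N choose s) * real s ^ s \<le> real (N choose s) * (exp s * fact s)"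
    by (rule mult_left_mono[OF *]) simp
  also have "\<dots> = (real (N choose s) * fact s) * exp s" by (simp only: mult_ac)
  also note **
  also have "exp (real s) = exp 1 ^ s" by (simp flip: exp_of_nat_mult)
  finally show ?thesis using assms by (simp add: power_mult_distrib power_divide field_simps)
qed

text \<open>The factor \<open>d * sqrt (s / N)\<close> is \<open>1 / x\<close> from Markov's
  inequality, and \<open>exp (- d)\<close> is the chance that a given vertex of \<open>S\<close> has
  no edges. All corrections go into \<open>exp 7\<close>: 5 in the exponent from the rows outside
  \<open>S\<close>, 1 from the exempt row, 1 from the edges inside \<open>S\<close>.\<close>

lemma prob_sealed_le_small:
  fixes d p :: real
  assumes V: "finite V" "S \<subseteq> V" and j: "j \<in> V - S" and p: "p \<le> 1 / 2" and d: "d = p * card V" "d \<ge> 4"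
    and S: "card S \<ge> 1" "card S * d\<^sup>2 \<le> card V"
  shows "EE p (pairs V) (\<lambda>E. ind (sealed E V j S)) \<le> (exp 7 * d * sqrt (card S / card V) * exp (- d)) ^ card S"
proof -
  define N where "N = real (card V)"
  define s where "s = real (card S)"
  \<comment> \<open>This is the largest order of \<open>x\<close> for which the corrections stay of
    size \<open>exp (O(s))\<close>: edges inside \<open>S\<close> add at most
    \<open>s^2 * x^2 * p = s / d\<close> to the exponent, the rows outside about
    \<open>N * (x * p * s)^2 = s\<close>. The assumption \<open>s * d^2 \<le> N\<close> amounts to
    \<open>x \<ge> 1\<close>.\<close>
  define x where "x = sqrt (N / s) / d"
  define y where "y = x * p / (1 - p)"
  define z where "z = s * y"
  define m where "m = card V - card S - 1"
  let ?\<psi> = "(1 - p + x * p) ^ card S - x * (card S * p * (1 - p) ^ (card S - 1))"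
  have fS: "finite S" using V finite_subset by blast
  have s1: "s \<ge> 1" using S by (simp add: s_def)
  have d16: "d\<^sup>2 \<ge> 16" using d(2) power_mono[of 4 d 2] by simp
  have "s * 16 \<le> s * d\<^sup>2" using d16 s1 by (intro mult_left_mono) auto
  then have N16: "16 * s \<le> N" using S(2) by (simp add: N_def s_def)
  then have N: "N > 0" using s1 by simp
  have p': "p = d / N" using d N by (simp add: N_def)
  then have p0: "p > 0" using d(2) N by (metis divide_pos_pos less_le_trans zero_less_numeral)
  have "d\<^sup>2 \<le> N / s" using S(2) s1 by (simp add: N_def s_def field_simps)
  then have "d \<le> sqrt (N / s)" using real_le_rsqrt by blast
  then have x1: "x \<ge> 1" using d(2) by (simp add: x_def)
  have r0: "sqrt (s / N) > 0" using s1 N by simp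
  have "sqrt (s / N) \<le> sqrt (1 / 16)" using N16 N by (intro real_sqrt_le_mono) (simp add: field_simps)
  also have "sqrt (1 / 16) = 1 / (4::real)" by (rule real_sqrt_unique) (auto simp: power2_eq_square)
  finally have r4: "sqrt (s / N) \<le> 1 / 4" .
  have Ns: "sqrt (N / s) * s / N = sqrt (s / N)"
  proof -
    have "sqrt (N / s) = sqrt (s / N) * (N / s)"
    proof (rule real_sqrt_unique)
      show "(sqrt (s / N) * (N / s))\<^sup>2 = N / s"
        unfolding power_mult_distrib using s1 N by (subst real_sqrt_pow2) (auto simp: power2_eq_square)
      show "0 \<le> sqrt (s / N) * (N / s)" using s1 N by simp
    qed
    then show ?thesis using s1 N by simp
  qed
  have xps: "x * p * s = sqrt (s / N)"
    using Ns d(2) by (simp add: x_def p' mult_ac)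
  have y0: "y \<ge> 0" using x1 p0 p by (simp add: y_def)
  have "1 - p \<ge> 1 / 2" using p by simp
  then have "y \<le> x * p / (1 / 2)" unfolding y_def using x1 p0 by (intro divide_left_mono) auto
  then have "z \<le> s * (x * p / (1 / 2))" unfolding z_def using s1 by (intro mult_left_mono) auto
  then have z_le: "z \<le> 2 * sqrt (s / N)" using xps by (simp add: mult_ac)
  have z0: "z \<ge> 0" using y0 s1 by (simp add: z_def)
  have z1: "z \<le> 1" using z_le r4 by simp
  have "z\<^sup>2 \<le> (2 * sqrt (s / N))\<^sup>2" using z_le z0 by (rule power_mono)
  then have z2: "z\<^sup>2 \<le> 4 * s / N" using s1 N by (simp add: power_mult_distrib)
  \<comment> \<open>Excluding exactly one neighbour removes the first-order term \<open>z\<close> of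
    \<open>(1 + y) ^ s\<close>. What is left is at most \<open>1 + z^2\<close>, so that all rows
    together cost only \<open>exp (4 * s)\<close>.\<close>
  have psi: "?\<psi> = (1 - p) ^ card S * ((1 + y) ^ card S - z)"
  proof -
    have "1 - p + x * p = (1 - p) * (1 + y)" using p by (simp add: y_def field_simps)
    moreover have "(1 - p) ^ card S = (1 - p) * (1 - p) ^ (card S - 1)"
      using S(1) by (simp flip: power_Suc)
    moreover have "(1 - p) * y = x * p" using p by (simp add: y_def)
    ultimately show ?thesis
      by (simp add: power_mult_distrib z_def s_def right_diff_distrib mult_ac)
  qed
  have "(1 + y) ^ card S \<le> exp y ^ card S" using y0 by (intro power_mono) auto
  also have "exp y ^ card S = exp z" by (simp add: z_def s_def exp_of_nat_mult)
  also have "exp z \<le> 1 + z + z\<^sup>2" using z0 z1 by (rule exp_bound)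
  finally have "(1 + y) ^ card S - z \<le> 1 + z\<^sup>2" by simp
  also have "\<dots> \<le> exp (z\<^sup>2)" by simp
  finally have b1: "(1 + y) ^ card S - z \<le> exp (z\<^sup>2)" .
  have "(1 - p) ^ card S \<le> exp (- p) ^ card S"
    using p exp_ge_add_one_self[of "- p"] by (intro power_mono) auto
  also have "exp (- p) ^ card S = exp (- p * s)" by (simp add: s_def mult.commute flip: exp_of_nat_mult)
  finally have "?\<psi> \<le> exp (- p * s) * exp (z\<^sup>2)"
    unfolding psi using p b1 Bernoulli_inequality[of y "card S"] y0
    by (intro mult_mono) (auto simp: z_def s_def)
  also have "\<dots> = exp (- p * s + z\<^sup>2)" by (simp only: exp_add)
  also have "\<dots> \<le> exp (- p * s + 4 * s / N)" using z2 by simp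
  finally have psi_le: "?\<psi> \<le> exp (- p * s + 4 * s / N)" .
  have psi0: "?\<psi> \<ge> 0"
    unfolding EE_power_card_neq_1[OF fS, symmetric] using p0 p x1 by (intro EE_nonneg) auto
  have mN: "real m = N - s - 1"
    using N16 s1 unfolding m_def N_def s_def by linarith
  have "?\<psi> ^ m \<le> exp (- p * s + 4 * s / N) ^ m" using psi_le psi0 by (rule power_mono)
  also have "\<dots> = exp (real m * (- p * s + 4 * s / N))" by (simp only: exp_of_nat_mult)
  also have "\<dots> \<le> exp (s * (- d + 5))"
  proof -
    have "real m * (4 * s / N) \<le> N * (4 * s / N)" using s1 N mN by (intro mult_right_mono) auto
    then have "real m * (4 * s / N) \<le> 4 * s" using N by simp
    moreover have "real m * (- p * s) \<le> s * (- d + 1)"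
    proof -
      have "s * d \<le> N / 4"
      proof -
        have "4 * (s * d) \<le> d * (s * d)" using d(2) s1 by (intro mult_right_mono) auto
        also have "\<dots> \<le> N" using S(2) by (simp add: N_def s_def power2_eq_square mult_ac)
        finally show ?thesis by simp
      qed
      then have "p * s \<le> 1 / 4" using N by (simp add: p' field_simps)
      then have "p * (s + 1) \<le> 1" using p by (simp add: algebra_simps)
      then have "s * (p * (s + 1)) \<le> s * 1" using s1 by (intro mult_left_mono) auto
      moreover have "p * N = d" using d by (simp add: N_def)
      then have "real m * (- p * s) = s * (p * (s + 1)) - s * d" unfolding mN by (simp add: algebra_simps flip: \<open>p * N = d\<close>)
      ultimately show ?thesis by (simp add: algebra_simps)
    qed
    ultimately show ?thesis by (simp add: algebra_simps)
  qed
  finally have f1: "?\<psi> ^ m \<le> exp (s * (- d + 5))" .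
  have "1 - p + x * p \<le> exp (x * p)" using p0 exp_ge_add_one_self[of "x * p"] by linarith
  then have "(1 - p + x * p) ^ card S \<le> exp (x * p) ^ card S"
    using p p0 x1 by (intro power_mono) auto
  also have "\<dots> = exp (real (card S) * (x * p))" by (simp only: exp_of_nat_mult)
  also have "real (card S) * (x * p) = sqrt (s / N)" using xps by (simp add: s_def mult_ac)
  also have "exp (sqrt (s / N)) \<le> exp s" using r4 s1 by simp
  finally have f2: "(1 - p + x * p) ^ card S \<le> exp s" .
  have "1 - p + x\<^sup>2 * p \<le> exp (x\<^sup>2 * p)" using p0 exp_ge_add_one_self[of "x\<^sup>2 * p"] by linarith
  then have "(1 - p + x\<^sup>2 * p) ^ (card S choose 2) \<le> exp (x\<^sup>2 * p) ^ (card S choose 2)"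
    using p p0 x1 by (intro power_mono) auto
  also have "\<dots> = exp (real (card S choose 2) * (x\<^sup>2 * p))" by (simp only: exp_of_nat_mult)
  also have "\<dots> \<le> exp s"
  proof -
    have "real (card S choose 2) \<le> s * s"
    proof -
      have "card S choose 2 \<le> card S * card S"
        unfolding choose_two by (meson div_le_dividend diff_le_self le_trans mult_le_mono2)
      then show ?thesis unfolding s_def by (metis of_nat_le_iff of_nat_mult)
    qed
    then have "real (card S choose 2) * (x\<^sup>2 * p) \<le> s * s * (x\<^sup>2 * p)"
      using p0 by (intro mult_right_mono) auto
    also have "\<dots> = s / d"
      using s1 N d(2) by (simp add: x_def p' power_divide power2_eq_square)
    also have "\<dots> \<le> s" using s1 d(2) by (simp add: field_simps)
    finally show ?thesis by simp
  qed
  finally have f3: "(1 - p + x\<^sup>2 * p) ^ (card S choose 2) \<le> exp s" .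
  have "EE p (pairs V) (\<lambda>E. ind (sealed E V j S)) \<le>
      (1 / x ^ card S) * ((1 - p + x\<^sup>2 * p) ^ (card S choose 2) * ((1 - p + x * p) ^ card S * ?\<psi> ^ m))"
    unfolding m_def using p0 p by (intro prob_sealed_le[OF V j _ _ x1]) auto
  also have "\<dots> \<le> (1 / x ^ card S) * (exp s * (exp s * exp (s * (- d + 5))))"
    using x1 p0 p psi0 by (intro mult_left_mono mult_mono f1 f2 f3) auto
  also have "exp s * (exp s * exp (s * (- d + 5))) = exp (7 - d) ^ card S"
    by (simp add: s_def algebra_simps flip: exp_add exp_of_nat_mult)
  also have "(1 / x ^ card S) * exp (7 - d) ^ card S = (exp (7 - d) / x) ^ card S"
    by (simp add: power_divide)
  also have "exp (7 - d) / x = exp 7 * d * sqrt (s / N) * exp (- d)"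
  proof -
    have "1 / x = d * sqrt (s / N)"
      using d(2) s1 N by (simp add: x_def real_sqrt_divide)
    moreover have "exp (7 - d) = exp 7 * exp (- d)" by (simp flip: exp_add)
    ultimately show ?thesis by (metis mult.assoc mult.commute times_divide_eq_right mult.right_neutral)
  qed
  finally show ?thesis by (simp add: s_def N_def)
qed

text \<open>Meant for \<open>s * d^2 > N\<close>, where there are at most about \<open>d^2\<close>
  choices per vertex of \<open>S\<close> and any exponential decay in \<open>d\<close> is enough; so
  \<open>x = 1\<close>. Each of at least \<open>card V / 2\<close> rows has exactly one neighbour in
  \<open>S\<close> with probability at least \<open>s * p * exp (- 2 * K)\<close>.\<close>

lemma prob_sealed_le_large:
  fixes d p K :: real
  assumes V: "finite V" "S \<subseteq> V" and j: "j \<in> V - S" and p: "0 < p" "p \<le> 1 / 2" and d: "d = p * card V"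
    and S: "card S \<ge> 1" "card S * p \<le> K" "4 * card S \<le> card V" "4 \<le> card V"
  shows "EE p (pairs V) (\<lambda>E. ind (sealed E V j S)) \<le> exp (- (exp (- 2 * K) / 2) * d) ^ card S"
proof -
  define m where "m = card V - card S - 1"
  define q where "q = card S * p * (1 - p) ^ (card S - 1)"
  have fS: "finite S" using V finite_subset by blast
  have "EE p (pairs V) (\<lambda>E. ind (sealed E V j S)) \<le> (1 - q) ^ m"
    using prob_sealed_le[OF V j, of p 1] p by (simp add: m_def q_def)
  also have "\<dots> \<le> exp (- q) ^ m"
  proof (rule power_mono)
    show "0 \<le> 1 - q"
      using EE_power_card_neq_1[OF fS, of p 1] EE_nonneg[of p S "\<lambda>F. of_bool (card F \<noteq> 1) * 1 ^ card F"] p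
      by (simp add: q_def)
  qed (use exp_ge_add_one_self[of "- q"] in auto)
  also have "\<dots> = exp (- (m * q))" by (simp flip: exp_of_nat_mult)
  also have "\<dots> \<le> exp (- (card S * (exp (- 2 * K) / 2 * d)))"
  proof -
    have "1 \<le> (1 - p) * (1 + 2 * p)"
      using mult_left_mono[of p "1 / 2" "2 * p"] p by (simp add: algebra_simps)
    also have "\<dots> \<le> (1 - p) * exp (2 * p)" using p by (intro mult_left_mono) auto
    finally have "exp (- (2 * p)) \<le> 1 - p" by (simp add: exp_minus field_simps)
    then have "exp (- (2 * p)) ^ card S \<le> (1 - p) ^ card S" by (intro power_mono) auto
    also have "\<dots> \<le> (1 - p) ^ (card S - 1)" using p by (intro power_decreasing) auto
    also have "exp (- (2 * p)) ^ card S = exp (- 2 * (card S * p))"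
      by (simp add: mult_ac flip: exp_of_nat_mult)
    finally have "exp (- 2 * (card S * p)) \<le> (1 - p) ^ (card S - 1)" .
    moreover have "exp (- 2 * K) \<le> exp (- 2 * (card S * p))" using S(2) by simp
    ultimately have "exp (- 2 * K) \<le> (1 - p) ^ (card S - 1)" by linarith
    then have "card S * p * exp (- 2 * K) \<le> q"
      unfolding q_def using p by (intro mult_left_mono) auto
    moreover have "card V / 2 \<le> real m" using S unfolding m_def by linarith
    ultimately have "card V / 2 * (card S * p * exp (- 2 * K)) \<le> m * q"
      using p by (intro mult_mono) auto
    then show ?thesis by (simp add: d mult_ac)
  qed
  also have "\<dots> = exp (- (exp (- 2 * K) / 2) * d) ^ card S" by (simp add: algebra_simps flip: exp_of_nat_mult)
  finally show ?thesis .
qed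

lemma of_bool_Bex_le_sum: "finite A \<Longrightarrow> ind (\<exists>a\<in>A. P a) \<le> (\<Sum>a\<in>A. ind (P a))"
proof (cases "\<exists>a\<in>A. P a")
  case True
  assume fin: "finite A"
  from True obtain a where a: "a \<in> A" "P a" by blast
  have "(\<Sum>b\<in>{a}. ind (P b)) \<le> (\<Sum>a\<in>A. ind (P a))"
    using a fin by (intro sum_mono2) auto
  then show ?thesis using a True by simp
qed (simp add: sum_nonneg)

lemma sum_power_from_1_le:
  fixes x :: real
  assumes "0 \<le> x" "x \<le> 1 / 2"
  shows "(\<Sum>i\<in>{1..n}. x ^ i) \<le> 2 * x"
proof -
  have "(\<Sum>i\<in>{1..n}. x ^ i) = x * (\<Sum>i<n. x ^ i)"
    by (simp add: sum.atLeast1_atMost_eq sum_distrib_left)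
  also have "\<dots> \<le> x * 2"
  proof (intro mult_left_mono)
    have "(1 - x) * (\<Sum>i<n. x ^ i) = 1 - x ^ n" by (rule one_diff_power_eq[symmetric])
    then have "(1 - x) * (\<Sum>i<n. x ^ i) \<le> 1" using assms by simp
    moreover have "1 / 2 * (\<Sum>i<n. x ^ i) \<le> (1 - x) * (\<Sum>i<n. x ^ i)"
      using assms by (intro mult_right_mono sum_nonneg) auto
    ultimately show "(\<Sum>i<n. x ^ i) \<le> 2" by simp
  qed (use assms in auto)
  finally show ?thesis by simp
qed

lemma eventually_exp_decay:
  fixes a b :: real
  assumes "a > 0" "b > 0"
  shows "eventually (\<lambda>d. exp 8 * d * exp (- a * d) + exp 1 * d\<^sup>2 * exp (- b * d) \<le> 1 / (2 * d)) at_top"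
proof -
  have "eventually (\<lambda>d. exp 8 * d * exp (- a * d) \<le> 1 / (4 * d)) at_top"
    using assms(1) by real_asymp
  moreover have "eventually (\<lambda>d. exp 1 * d\<^sup>2 * exp (- b * d) \<le> 1 / (4 * d)) at_top"
    using assms(2) by real_asymp
  ultimately show ?thesis by eventually_elim (simp add: field_simps)
qed

text \<open>The assumption \<open>card V \<le> exp (2 * \<gamma> * d)\<close> with
  \<open>d = p * card V\<close> is the form in which c > 1/2 enters: it says that
  \<open>sqrt (card V) \<le> exp (\<gamma> * d)\<close>, which loses against
  \<open>exp (- d)\<close> as \<open>\<gamma> < 1\<close>.\<close>

lemma prob_ex_sealed_le:
  fixes \<gamma> K :: real
  assumes \<gamma>: "\<gamma> < 1" and K: "K > 0"
  shows "\<exists>d0\<ge>4. \<forall>(V :: 'a set) (p :: real) j. finite V \<longrightarrow> p \<le> 1 / 2 \<longrightarrow> d0 \<le> p * card V \<longrightarrow>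
    card V \<le> exp (2 * \<gamma> * (p * card V)) \<longrightarrow>
    EE p (pairs V) (\<lambda>E. ind (\<exists>S\<subseteq>V. S \<noteq> {} \<and> card S * p \<le> K \<and> sealed E V j S)) \<le> 1 / (p * card V)"
proof -
  define \<kappa> where "\<kappa> = exp (- 2 * K) / 2"
  \<comment> \<open>Each summand bounds \<open>exp 1 * N / s\<close> times the cost per vertex of
    \<open>S\<close>. The first one, for \<open>s * d^2 \<le> N\<close>, uses
    \<open>N / s * sqrt (s / N) \<le> sqrt N \<le> exp (\<gamma> * d)\<close>; the second one uses
    \<open>N / s \<le> d^2\<close>.\<close>
  define B where "B d = exp 8 * d * exp (- (1 - \<gamma>) * d) + exp 1 * d\<^sup>2 * exp (- \<kappa> * d)" for d
  have "\<kappa> > 0" "1 - \<gamma> > 0" using \<gamma> by (simp_all add: \<kappa>_def)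
  then have "eventually (\<lambda>d. B d \<le> 1 / (2 * d)) at_top"
    unfolding B_def by (intro eventually_exp_decay)
  then obtain d1 where d1: "\<And>d. d \<ge> d1 \<Longrightarrow> B d \<le> 1 / (2 * d)"
    unfolding eventually_at_top_linorder by blast
  \<comment> \<open>The bound \<open>d \<ge> 4 * K\<close> ensures that
    \<open>card S * p \<le> K\<close> implies \<open>4 * card S \<le> card V\<close>.\<close>
  define d0 where "d0 = max 4 (max d1 (4 * K))"
  have "EE p (pairs V) (\<lambda>E. ind (\<exists>S\<subseteq>V. S \<noteq> {} \<and> card S * p \<le> K \<and> sealed E V j S)) \<le> 1 / (p * card V)"
    if V: "finite V" and p: "p \<le> 1 / 2" and dV: "d0 \<le> p * card V"
      and NV: "card V \<le> exp (2 * \<gamma> * (p * card V))" for V :: "'a set" and p :: real and j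
  proof -
    define d where "d = p * card V"
    define N where "N = card V"
    have d: "d \<ge> 4" "d \<ge> d1" "d \<ge> 4 * K" using dV by (auto simp: d_def d0_def)
    have N: "real N > 0" using d(1) d_def by (cases "card V = 0") (auto simp: N_def)
    have p0: "p > 0" using d(1) N unfolding d_def N_def by (metis less_le_trans mult_le_0_iff not_less of_nat_0_le_iff zero_less_numeral)
    have "4 \<le> p * N" using d(1) by (simp add: d_def N_def)
    also have "p * N \<le> 1 / 2 * N" using p by (intro mult_right_mono) auto
    finally have N8: "N \<ge> 8" by simp
    define T where "T = {s \<in> {1..N}. s * p \<le> K}"
    define q where "q s = (if s * d\<^sup>2 \<le> N then exp 7 * d * sqrt (s / N) * exp (- d) else exp (- \<kappa> * d))" for s :: nat
    have fam: "finite {S. S \<subseteq> V \<and> card S = s}" for s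
      using V by (auto intro: finite_subset[of _ "Pow V"])
    have one: "EE p (pairs V) (\<lambda>E. ind (sealed E V j S)) \<le> q s ^ s"
      if s: "s \<in> T" and S: "S \<subseteq> V" "card S = s" for s S
    proof -
      have "4 * s * p \<le> 4 * K" using s by (simp add: T_def)
      also have "\<dots> \<le> p * N" using d(3) by (simp add: d_def N_def)
      finally have "real (4 * s) \<le> real N" using p0 by (simp add: mult.commute)
      then have s4: "4 * s \<le> N" by (simp only: of_nat_le_iff)
      then have "S \<noteq> V" using S s by (auto simp: N_def T_def)
      then have "V - S \<noteq> {}" using S by blast
      \<comment> \<open>If \<open>j\<close> is not in \<open>V - S\<close>, its exemption is void,
        and exempting some other vertex \<open>j'\<close> outside \<open>S\<close> only weakens
        \<open>sealed\<close>.\<close>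
      then obtain j' where j': "j' \<in> V - S" "j \<in> V - S \<Longrightarrow> j' = j" by blast
      have "EE p (pairs V) (\<lambda>E. ind (sealed E V j S)) \<le> EE p (pairs V) (\<lambda>E. ind (sealed E V j' S))"
        using p0 p j' by (intro EE_mono) (auto simp: sealed_def)
      also have "\<dots> \<le> q s ^ s"
      proof (cases "s * d\<^sup>2 \<le> N")
        case True
        then show ?thesis
          using prob_sealed_le_small[OF V S(1) j'(1) p d_def d(1)] s S(2)
          by (simp add: q_def N_def T_def)
      next
        case False
        then show ?thesis
          using prob_sealed_le_large[OF V S(1) j'(1) p0 p d_def, of K] s S(2) s4 N8
          by (simp add: q_def N_def T_def \<kappa>_def)
      qed
      finally show ?thesis .
    qed
    have two: "real (N choose s) * q s ^ s \<le> B d ^ s" if s: "s \<in> T" for s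
    proof -
      have s1: "s \<ge> 1" using s by (simp add: T_def)
      have q0: "q s \<ge> 0" using d by (simp add: q_def)
      have "real (N choose s) * q s ^ s \<le> (exp 1 * N / s) ^ s * q s ^ s"
        using binomial_le_exp_power[OF s1] q0 by (intro mult_right_mono) auto
      also have "\<dots> = (exp 1 * N / s * q s) ^ s" by (simp only: power_mult_distrib)
      also have "\<dots> \<le> B d ^ s"
      proof (rule power_mono)
        show "exp 1 * N / s * q s \<le> B d"
        proof (cases "s * d\<^sup>2 \<le> N")
          case True
          have "real N / s * sqrt (s / N) = sqrt (N / s)"
          proof (rule real_sqrt_unique[symmetric])
            show "(real N / s * sqrt (s / N))\<^sup>2 = N / s"
              unfolding power_mult_distrib using s1 N by (subst real_sqrt_pow2) (auto simp: power2_eq_square)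
          qed simp
          also have "\<dots> \<le> sqrt N" using s1 N by (intro real_sqrt_le_mono) (simp add: field_simps)
          also have "\<dots> \<le> sqrt ((exp (\<gamma> * d))\<^sup>2)"
            using NV by (intro real_sqrt_le_mono) (simp add: N_def d_def mult_ac flip: exp_double)
          also have "\<dots> = exp (\<gamma> * d)" by simp
          finally have le: "real N / s * sqrt (s / N) \<le> exp (\<gamma> * d)" .
          have "exp 1 * N / s * q s = (exp 1 * exp 7) * d * exp (- d) * (real N / s * sqrt (s / N))"
            using True by (simp add: q_def)
          also have "\<dots> \<le> (exp 1 * exp 7) * d * exp (- d) * exp (\<gamma> * d)"
            using d(1) by (intro mult_left_mono le) auto
          also have "\<dots> = exp 8 * d * exp (- (1 - \<gamma>) * d)"
          proof -
            have "exp 1 * exp 7 = exp (8::real)" by (simp flip: exp_add)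
            moreover have "exp (- d) * exp (\<gamma> * d) = exp (- (1 - \<gamma>) * d)"
              by (simp add: algebra_simps flip: exp_add)
            ultimately show ?thesis by (metis mult.assoc)
          qed
          also have "\<dots> \<le> B d" by (simp add: B_def)
          finally show ?thesis .
        next
          case False
          then have "real N / s \<le> d\<^sup>2" using s1 by (simp add: field_simps)
          then have "exp 1 * (real N / s) * q s \<le> exp 1 * d\<^sup>2 * q s"
            using q0 by (intro mult_right_mono mult_left_mono) auto
          also have "\<dots> \<le> B d" using False d(1) by (simp add: q_def B_def)
          finally show ?thesis by simp
        qed
      qed (use q0 in auto)
      finally show ?thesis .
    qed
    have Bd: "B d \<le> 1 / (2 * d)" "B d \<ge> 0" using d1[OF d(2)] d(1) by (auto simp: B_def)
    have "1 / (2 * d) \<le> 1 / 2" using d(1) by (simp add: field_simps)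
    then have B2: "B d \<le> 1 / 2" using Bd by simp
    have "EE p (pairs V) (\<lambda>E. ind (\<exists>S\<subseteq>V. S \<noteq> {} \<and> card S * p \<le> K \<and> sealed E V j S))
      \<le> EE p (pairs V) (\<lambda>E. \<Sum>s\<in>T. \<Sum>S | S \<subseteq> V \<and> card S = s. ind (sealed E V j S))"
    proof (rule EE_mono)
      fix E
      have "ind (\<exists>S\<subseteq>V. S \<noteq> {} \<and> card S * p \<le> K \<and> sealed E V j S)
        \<le> ind (\<exists>s\<in>T. \<exists>S\<in>{S. S \<subseteq> V \<and> card S = s}. sealed E V j S)"
      proof -
        have "\<exists>s\<in>T. \<exists>S\<in>{S. S \<subseteq> V \<and> card S = s}. sealed E V j S"
          if "S \<subseteq> V" "S \<noteq> {}" "card S * p \<le> K" "sealed E V j S" for S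
        proof
          have "card S \<noteq> 0" "card S \<le> N"
            using that(1,2) V by (auto simp: N_def card_eq_0_iff card_mono dest: finite_subset)
          then show "card S \<in> T" using that(3) by (simp add: T_def)
        qed (use that in auto)
        then show ?thesis by auto
      qed
      also have "\<dots> \<le> (\<Sum>s\<in>T. ind (\<exists>S\<in>{S. S \<subseteq> V \<and> card S = s}. sealed E V j S))"
        by (rule of_bool_Bex_le_sum) (simp add: T_def)
      also have "\<dots> \<le> (\<Sum>s\<in>T. \<Sum>S | S \<subseteq> V \<and> card S = s. ind (sealed E V j S))"
        by (intro sum_mono of_bool_Bex_le_sum fam)
      finally show "ind (\<exists>S\<subseteq>V. S \<noteq> {} \<and> card S * p \<le> K \<and> sealed E V j S)
        \<le> (\<Sum>s\<in>T. \<Sum>S | S \<subseteq> V \<and> card S = s. ind (sealed E V j S))" .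
    qed (use p0 p in auto)
    also have "\<dots> = (\<Sum>s\<in>T. \<Sum>S | S \<subseteq> V \<and> card S = s. EE p (pairs V) (\<lambda>E. ind (sealed E V j S)))"
      by (simp only: EE_sum)
    also have "\<dots> \<le> (\<Sum>s\<in>T. \<Sum>S | S \<subseteq> V \<and> card S = s. q s ^ s)"
      using one by (intro sum_mono) auto
    also have "\<dots> = (\<Sum>s\<in>T. real (N choose s) * q s ^ s)"
      using n_subsets[OF V] by (simp add: N_def)
    also have "\<dots> \<le> (\<Sum>s\<in>T. B d ^ s)" using two by (rule sum_mono)
    also have "\<dots> \<le> (\<Sum>s\<in>{1..N}. B d ^ s)" using Bd(2) by (intro sum_mono2) (auto simp: T_def)
    also have "\<dots> \<le> 2 * B d" using Bd(2) B2 by (rule sum_power_from_1_le)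
    also have "\<dots> \<le> 1 / d" using Bd(1) d(1) by (simp add: field_simps)
    finally show ?thesis by (simp add: d_def)
  qed
  moreover have "d0 \<ge> 4" by (simp add: d0_def)
  ultimately show ?thesis by blast
qed

section \<open>Kernel vectors of medium support\<close>

text \<open>Union bound over the sets \<open>I\<close> of at most \<open>card S\<close> rows that span all rows: the solution \<open>w I E\<close>
  depends only on the rows in \<open>I\<close>, hence is independent of the other ones.\<close>

lemma prob_full_support_kernel_le:
  fixes p f :: real
  assumes V: "finite V" "S \<subseteq> V" and p: "0 < p" "p \<le> 1 / 2" and S: "S \<noteq> {}"
    and f: "9 / sqrt (card S * p) \<le> f" "f \<le> 1"
  shows "EE p (pairs V) (\<lambda>E. ind (\<exists>x::'a \<Rightarrow> real. (\<forall>v\<in>S. x v \<noteq> 0) \<and> (\<forall>u\<in>V - S - {j}. sum x (nbrs E u S) = 0)))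
    \<le> 2 ^ card V * f ^ (card V - 1 - 2 * card S)"
proof -
  define U where "U = V - S - {j}"
  define full where "full x \<longleftrightarrow> (\<forall>v\<in>S. x v \<noteq> 0)" for x :: "'a \<Rightarrow> real"
  define w where "w I E = (SOME x::'a \<Rightarrow> real. full x \<and> (\<forall>u\<in>I. sum x (nbrs E u S) = 0))" for I E
  define ev where "ev I E \<longleftrightarrow> full (w I E) \<and> (\<forall>u\<in>U - I. sum (w I E) (nbrs E u S) = 0)" for I E
  define \<I> where "\<I> = {I. I \<subseteq> U \<and> card I \<le> card S}"
  have fin: "finite S" "finite U" using V by (auto simp: U_def intro: finite_subset)
  have cS: "card S > 0" using fin S by (simp add: card_gt_0_iff)
  have f0: "f \<ge> 0"
  proof -
    have "0 \<le> 9 / sqrt (card S * p)" using p by simp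
    then show ?thesis using f(1) by linarith
  qed
  have fin\<I>: "finite \<I>" unfolding \<I>_def by (rule finite_subset[of _ "Pow U"]) (use fin in auto)
  have nb: "sum x (nbrs E u S) = (\<Sum>v\<in>S. ind ({u, v} \<in> E) * x v)" for x :: "'a \<Rightarrow> real" and E u
    unfolding nbrs_def using fin by (simp add: sum.inter_filter of_bool_def if_distrib[of "\<lambda>t. t * _"] cong: if_cong)
  have ex: "\<exists>I\<in>\<I>. ev I E" if x: "\<forall>v\<in>S. x v \<noteq> 0" "\<forall>u\<in>U. sum x (nbrs E u S) = 0" for x :: "'a \<Rightarrow> real" and E
  proof -
    obtain I where I: "I \<subseteq> U" "card I \<le> card S"
      "\<forall>x. (\<forall>u\<in>I. (\<Sum>v\<in>S. ind ({u, v} \<in> E) * x v) = 0) \<longrightarrow> (\<forall>u\<in>U. (\<Sum>v\<in>S. ind ({u, v} \<in> E) * x v) = 0)"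
      using spanning_rows_exist[OF fin(1), of U "\<lambda>u v. ind ({u, v} \<in> E)"] by blast
    have "full x \<and> (\<forall>u\<in>I. sum x (nbrs E u S) = 0)" using x I(1) by (auto simp: full_def)
    then have "full (w I E) \<and> (\<forall>u\<in>I. sum (w I E) (nbrs E u S) = 0)"
      unfolding w_def by (rule someI[where P = "\<lambda>x. full x \<and> (\<forall>u\<in>I. sum x (nbrs E u S) = 0)"])
    then have "ev I E" using I(3) unfolding ev_def nb by blast
    then show ?thesis using I(1,2) by (auto simp: \<I>_def)
  qed
  have one: "EE p (pairs V) (\<lambda>E. ind (ev I E)) \<le> f ^ (card V - 1 - 2 * card S)" if I: "I \<in> \<I>" for I
  proof -
    define A where "A = (\<Union>u\<in>U - I. star u S)"
    have IU: "I \<subseteq> U" "card I \<le> card S" using I by (auto simp: \<I>_def)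
    have subA: "A \<subseteq> pairs V"
      unfolding A_def using V(2) by (intro UN_least star_subset_pairs) (auto simp: U_def)
    have finA: "finite A" "finite (pairs V - A)" using V(1) subA by (auto intro: finite_subset)
    have inner: "EE p A (\<lambda>G. ind (ev I (H \<union> G))) \<le> f ^ (card V - 1 - 2 * card S)"
      if H: "H \<subseteq> pairs V - A" for H
    proof -
      let ?x = "w I H"
      have "EE p A (\<lambda>G. ind (ev I (H \<union> G))) \<le> EE p A (\<lambda>G. \<Prod>u\<in>U - I. ind (full ?x \<and> sum ?x (nbrs G u S) = 0))"
      proof (rule EE_mono)
        fix G assume G: "G \<subseteq> A"
        have "nbrs (H \<union> G) u S = nbrs H u S" if "u \<in> I" for u
        proof -
          have "star u S \<inter> A = {}"
            using that IU(1) unfolding A_def by (auto simp: star_def doubleton_eq_iff U_def)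
          then show ?thesis using G by (auto simp: nbrs_def star_def)
        qed
        then have wH: "w I (H \<union> G) = w I H" by (simp add: w_def)
        have "nbrs (H \<union> G) u S = nbrs G u S" if "u \<in> U - I" for u
          using that H unfolding A_def by (auto simp: nbrs_def star_def)
        then have "ind (full ?x \<and> sum ?x (nbrs G u S) = 0) = (1::real)" if "ev I (H \<union> G)" "u \<in> U - I" for u
          using that by (auto simp: ev_def wH)
        then have "(\<Prod>u\<in>U - I. ind (full ?x \<and> sum ?x (nbrs G u S) = 0)) = (1::real)" if "ev I (H \<union> G)"
          using that by (intro prod.neutral) auto
        moreover have "0 \<le> (\<Prod>u\<in>U - I. ind (full ?x \<and> sum ?x (nbrs G u S) = 0))" by (intro prod_nonneg) auto
        ultimately show "ind (ev I (H \<union> G)) \<le> (\<Prod>u\<in>U - I. ind (full ?x \<and> sum ?x (nbrs G u S) = 0))"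
          by (cases "ev I (H \<union> G)") simp_all
      qed (use p in auto)
      also have "\<dots> = (\<Prod>u\<in>U - I. EE p S (\<lambda>F. ind (full ?x \<and> sum ?x F = 0)))"
        unfolding A_def by (rule EE_stars) (use fin in \<open>auto simp: U_def\<close>)
      also have "\<dots> = EE p S (\<lambda>F. ind (full ?x \<and> sum ?x F = 0)) ^ card (U - I)" by simp
      also have "\<dots> \<le> f ^ card (U - I)"
      proof (rule power_mono)
        show "EE p S (\<lambda>F. ind (full ?x \<and> sum ?x F = 0)) \<le> f"
        proof (cases "full ?x")
          case True
          then have "{v \<in> S. ?x v \<noteq> 0} = S" by (auto simp: full_def)
          then have "EE p S (\<lambda>F. ind (sum ?x F = 0)) \<le> 9 / sqrt (card S * p)"
            using cS p fin by (intro littlewood_offord) auto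
          then show ?thesis using f(1) True by simp
        qed (use f0 fin in simp)
        show "0 \<le> EE p S (\<lambda>F. ind (full ?x \<and> sum ?x F = 0))" using p by (intro EE_nonneg) auto
      qed
      also have "\<dots> \<le> f ^ (card V - 1 - 2 * card S)"
      proof (rule power_decreasing)
        have "card U \<ge> card V - card S - 1"
          unfolding U_def using fin V by (metis card_Diff_subset diff_card_le_card_Diff finite.emptyI finite.insertI card.empty card.insert empty_iff One_nat_def)
        moreover have "card (U - I) \<ge> card U - card I"
          using fin IU(1) by (simp add: card_Diff_subset finite_subset)
        ultimately show "card V - 1 - 2 * card S \<le> card (U - I)" using IU(2) by linarith
      qed (use f0 f in auto)
      finally show ?thesis .
    qed
    have "EE p (pairs V) (\<lambda>E. ind (ev I E)) = EE p ((pairs V - A) \<union> A) (\<lambda>E. ind (ev I E))"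
      using subA by (simp add: Un_absorb2)
    also have "\<dots> = EE p (pairs V - A) (\<lambda>H. EE p A (\<lambda>G. ind (ev I (H \<union> G))))"
      using finA by (intro EE_union) auto
    also have "\<dots> \<le> EE p (pairs V - A) (\<lambda>H. f ^ (card V - 1 - 2 * card S))"
      using p by (intro EE_mono inner) auto
    finally show ?thesis using finA by simp
  qed
  have "EE p (pairs V) (\<lambda>E. ind (\<exists>x::'a \<Rightarrow> real. (\<forall>v\<in>S. x v \<noteq> 0) \<and> (\<forall>u\<in>V - S - {j}. sum x (nbrs E u S) = 0)))
    \<le> EE p (pairs V) (\<lambda>E. \<Sum>I\<in>\<I>. ind (ev I E))"
  proof (rule EE_mono)
    fix E
    have "ind (\<exists>x::'a \<Rightarrow> real. (\<forall>v\<in>S. x v \<noteq> 0) \<and> (\<forall>u\<in>V - S - {j}. sum x (nbrs E u S) = 0)) \<le> ind (\<exists>I\<in>\<I>. ev I E)"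
      using ex[of _ E] unfolding U_def by auto
    also have "\<dots> \<le> (\<Sum>I\<in>\<I>. ind (ev I E))" by (rule of_bool_Bex_le_sum[OF fin\<I>])
    finally show "ind (\<exists>x::'a \<Rightarrow> real. (\<forall>v\<in>S. x v \<noteq> 0) \<and> (\<forall>u\<in>V - S - {j}. sum x (nbrs E u S) = 0))
      \<le> (\<Sum>I\<in>\<I>. ind (ev I E))" .
  qed (use p in auto)
  also have "\<dots> \<le> (\<Sum>I\<in>\<I>. f ^ (card V - 1 - 2 * card S))"
    unfolding EE_sum using one by (rule sum_mono)
  also have "\<dots> = card \<I> * f ^ (card V - 1 - 2 * card S)" by simp
  also have "\<dots> \<le> 2 ^ card V * f ^ (card V - 1 - 2 * card S)"
  proof (rule mult_right_mono)
    have "card \<I> \<le> card (Pow V)"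
      using V by (intro card_mono) (auto simp: \<I>_def U_def)
    then have "card \<I> \<le> 2 ^ card V" using V by (simp add: card_Pow)
    then show "real (card \<I>) \<le> 2 ^ card V" by (metis of_nat_le_iff of_nat_numeral of_nat_power)
  qed (use f0 in auto)
  finally show ?thesis .
qed

section \<open>All small supports together\<close>

text \<open>With row \<open>j\<close> left out, the definition covers both kernel vectors and the
  column at \<open>j\<close> of the inverse on the nonisolated vertices. An isolated
  \<open>j\<close> has no such column and is counted as exceptional.\<close>

definition exceptional :: "'a set set \<Rightarrow> 'a set \<Rightarrow> 'a \<Rightarrow> bool" where
  "exceptional E V j \<longleftrightarrow> j \<notin> nonisolated E V \<or>
    (\<exists>x::'a \<Rightarrow> real. {v \<in> V. x v \<noteq> 0} \<noteq> {} \<and> {v \<in> V. x v \<noteq> 0} \<subseteq> nonisolated E V \<and>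
      4 * card {v \<in> V. x v \<noteq> 0} < card V \<and> (\<forall>u\<in>V - {j}. sum x (nbrs E u V) = 0))"

lemma prob_isolated:
  fixes p :: real
  assumes "finite V" "j \<in> V"
  shows "EE p (pairs V) (\<lambda>E. ind (j \<notin> nonisolated E V)) = (1 - p) ^ (card V - 1)"
proof -
  \<comment> \<open>\<open>0 ^ card F\<close> is the indicator of an empty \<open>F\<close>, so that
    \<open>EE_power_card\<close> evaluates it.\<close>
  have "EE p (pairs V) (\<lambda>E. ind (j \<notin> nonisolated E V))
    = EE p (pairs V) (\<lambda>E. 1 * (\<Prod>u\<in>{j}. 0 ^ card (nbrs E u (V - {j}))))"
  proof (rule EE_cong)
    fix E assume "E \<subseteq> pairs V"
    then have "{j, j} \<notin> E" using pair_in_pairs_iff[of j j V] by blast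
    then have "j \<notin> nonisolated E V \<longleftrightarrow> nbrs E j (V - {j}) = {}"
      using assms(2) by (auto simp: nonisolated_def nbrs_def insert_commute)
    then show "ind (j \<notin> nonisolated E V) = 1 * (\<Prod>u\<in>{j}. 0 ^ card (nbrs E u (V - {j})))"
      using assms(1) by (simp add: power_0_left card_eq_0_iff)
  qed
  also have "\<dots> = EE p (pairs (V - {j})) (\<lambda>_. 1) * (\<Prod>u\<in>{j}. EE p (V - {j}) (\<lambda>F. 0 ^ card F))"
    using assms by (intro EE_pairs_stars) auto
  also have "\<dots> = (1 - p) ^ (card V - 1)"
    using assms by (simp add: EE_power_card)
  finally show ?thesis .
qed

text \<open>331776 is the square of 576, which makes the Littlewood-Offord bound
  \<open>9 / 576 = 1 / 64\<close>. At least \<open>card V / 2 - 1\<close> independent rows cost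
  \<open>64 * (1 / 8) ^ card V\<close>, and the choices of \<open>S\<close> and of the spanning rows
  give back at most \<open>4 ^ card V\<close>.\<close>

lemma prob_medium_support_kernel_le:
  fixes p :: real
  assumes V: "finite V" "card V \<ge> 2" and p: "0 < p" "p \<le> 1 / 2"
  shows "EE p (pairs V) (\<lambda>E. ind (\<exists>S\<subseteq>V. 331776 \<le> card S * p \<and> 4 * card S \<le> card V \<and>
      (\<exists>x::'a \<Rightarrow> real. (\<forall>v\<in>S. x v \<noteq> 0) \<and> (\<forall>u\<in>V - S - {j}. sum x (nbrs E u S) = 0)))) \<le> 64 / card V"
proof -
  define \<S> where "\<S> = {S. S \<subseteq> V \<and> 331776 \<le> card S * p \<and> 4 * card S \<le> card V}"
  define ev where "ev S E \<longleftrightarrow> (\<exists>x::'a \<Rightarrow> real. (\<forall>v\<in>S. x v \<noteq> 0) \<and> (\<forall>u\<in>V - S - {j}. sum x (nbrs E u S) = 0))" for S E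
  have fin: "finite \<S>" unfolding \<S>_def by (rule finite_subset[of _ "Pow V"]) (use V in auto)
  have one: "EE p (pairs V) (\<lambda>E. ind (ev S E)) \<le> 2 ^ card V * (64 * (1 / 8) ^ card V)" if S: "S \<in> \<S>" for S
  proof -
    have S': "S \<subseteq> V" "331776 \<le> card S * p" "4 * card S \<le> card V" using S by (auto simp: \<S>_def)
    have "sqrt 331776 \<le> sqrt (card S * p)" using S'(2) by (rule real_sqrt_le_mono)
    moreover have "sqrt 331776 = (576::real)" by (rule real_sqrt_unique) auto
    ultimately have "9 / sqrt (card S * p) \<le> 9 / 576" using S'(2) by (intro divide_left_mono) linarith+
    then have f: "9 / sqrt (card S * p) \<le> 1 / 64" by simp
    have "S \<noteq> {}" using S'(2) by auto
    then have "EE p (pairs V) (\<lambda>E. ind (ev S E)) \<le> 2 ^ card V * (1 / 64) ^ (card V - 1 - 2 * card S)"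
      unfolding ev_def using f by (intro prob_full_support_kernel_le[OF V(1) S'(1) p]) auto
    also have "(1 / 64 :: real) ^ (card V - 1 - 2 * card S) = (1 / 8) ^ (2 * (card V - 1 - 2 * card S))"
      unfolding power_mult by (simp add: power2_eq_square)
    also have "\<dots> \<le> (1 / 8) ^ (card V - 2)"
      using S'(3) V(2) by (intro power_decreasing) auto
    also have "(1 / 8 :: real) ^ (card V - 2) = 64 * (1 / 8) ^ card V"
    proof -
      obtain m where "card V = m + 2" using V(2) by (metis add.commute le_Suc_ex)
      then show ?thesis by (simp add: power_add)
    qed
    finally show ?thesis by simp
  qed
  have "EE p (pairs V) (\<lambda>E. ind (\<exists>S\<in>\<S>. ev S E)) \<le> EE p (pairs V) (\<lambda>E. \<Sum>S\<in>\<S>. ind (ev S E))"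
    using p by (intro EE_mono of_bool_Bex_le_sum fin) auto
  also have "\<dots> \<le> (\<Sum>S\<in>\<S>. 2 ^ card V * (64 * (1 / 8) ^ card V))"
    unfolding EE_sum using one by (rule sum_mono)
  also have "\<dots> = card \<S> * (2 ^ card V * (64 * (1 / 8) ^ card V))" by simp
  also have "\<dots> \<le> 2 ^ card V * (2 ^ card V * (64 * (1 / 8) ^ card V))"
  proof (rule mult_right_mono)
    have "card \<S> \<le> card (Pow V)" using V by (intro card_mono) (auto simp: \<S>_def)
    then have "card \<S> \<le> 2 ^ card V" using V by (simp add: card_Pow)
    then show "real (card \<S>) \<le> 2 ^ card V" by (metis of_nat_le_iff of_nat_numeral of_nat_power)
  qed simp
  also have "\<dots> = 64 * (1 / 2) ^ card V"
    by (simp add: field_simps flip: power_mult_distrib)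
  also have "\<dots> \<le> 64 / card V"
  proof -
    have "real (card V) \<le> 2 ^ card V" by (metis less_exp less_imp_le of_nat_le_iff of_nat_numeral of_nat_power)
    then show ?thesis using V(2) by (simp add: power_one_over field_simps)
  qed
  finally show ?thesis unfolding \<S>_def ev_def by (simp add: Bex_def conj_assoc)
qed

text \<open>The three causes are an isolated \<open>j\<close>, a sealed support and a medium
  support. They contribute \<open>exp 1\<close>, 1 and 64 to the numerator.\<close>

lemma prob_exceptional_le:
  fixes \<gamma> :: real
  assumes \<gamma>: "\<gamma> < 1"
  shows "\<exists>d0\<ge>4. \<forall>(V :: 'a set) (p :: real) j. finite V \<longrightarrow> j \<in> V \<longrightarrow> p \<le> 1 / 2 \<longrightarrow> d0 \<le> p * card V \<longrightarrow>
    card V \<le> exp (2 * \<gamma> * (p * card V)) \<longrightarrow>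
    EE p (pairs V) (\<lambda>E. ind (exceptional E V j)) \<le> 70 / (p * card V)"
proof -
  obtain d0 :: real where d0: "d0 \<ge> 4" and sealed_le: "\<And>(V :: 'a set) (p :: real) j. finite V \<Longrightarrow> p \<le> 1 / 2 \<Longrightarrow> d0 \<le> p * card V \<Longrightarrow>
    card V \<le> exp (2 * \<gamma> * (p * card V)) \<Longrightarrow>
    EE p (pairs V) (\<lambda>E. ind (\<exists>S\<subseteq>V. S \<noteq> {} \<and> card S * p \<le> 331776 \<and> sealed E V j S)) \<le> 1 / (p * card V)"
    using prob_ex_sealed_le[OF \<gamma>, of 331776, where 'a = 'a] zero_less_numeral by blast
  have "EE p (pairs V) (\<lambda>E. ind (exceptional E V j)) \<le> 70 / (p * card V)"
    if V: "finite V" and j: "j \<in> V" and p: "p \<le> 1 / 2" and dV: "d0 \<le> p * card V"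
      and NV: "card V \<le> exp (2 * \<gamma> * (p * card V))" for V :: "'a set" and p :: real and j
  proof -
    define d where "d = p * card V"
    have d4: "d \<ge> 4" using dV d0 by (simp add: d_def)
    have N0: "real (card V) > 0" using V j by (auto simp: card_gt_0_iff)
    have p0: "p > 0" using d4 N0 unfolding d_def by (metis less_le_trans mult_le_0_iff not_less of_nat_0_le_iff zero_less_numeral)
    have "d \<le> 1 / 2 * card V" unfolding d_def using p by (intro mult_right_mono) auto
    then have dN: "2 * d \<le> card V" by simp
    then have N2: "card V \<ge> 2" using d4 by linarith
    define A1 where "A1 E \<longleftrightarrow> j \<notin> nonisolated E V" for E
    define A2 where "A2 E \<longleftrightarrow> (\<exists>S\<subseteq>V. S \<noteq> {} \<and> card S * p \<le> 331776 \<and> sealed E V j S)" for E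
    define A3 where "A3 E \<longleftrightarrow> (\<exists>S\<subseteq>V. 331776 \<le> card S * p \<and> 4 * card S \<le> card V \<and>
      (\<exists>x::'a \<Rightarrow> real. (\<forall>v\<in>S. x v \<noteq> 0) \<and> (\<forall>u\<in>V - S - {j}. sum x (nbrs E u S) = 0)))" for E
    have split: "A1 E \<or> A2 E \<or> A3 E" if exE: "exceptional E V j" for E
    proof (rule ccontr)
      assume neg: "\<not> (A1 E \<or> A2 E \<or> A3 E)"
      then obtain x :: "'a \<Rightarrow> real" where x: "{v \<in> V. x v \<noteq> 0} \<noteq> {}" "{v \<in> V. x v \<noteq> 0} \<subseteq> nonisolated E V"
        "4 * card {v \<in> V. x v \<noteq> 0} < card V" "\<And>u. u \<in> V - {j} \<Longrightarrow> sum x (nbrs E u V) = 0"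
        using exE unfolding exceptional_def A1_def by blast
      define S where "S = {v \<in> V. x v \<noteq> 0}"
      have SV: "S \<subseteq> V" by (auto simp: S_def)
      have "sum x (nbrs E u S) = sum x (nbrs E u V)" for u
        using V by (intro sum.mono_neutral_left) (auto simp: nbrs_def S_def)
      then have zero: "sum x (nbrs E u S) = 0" if "u \<in> V - S - {j}" for u
        using x(4) that by auto
      show False
      proof (cases "card S * p \<le> 331776")
        case True
        have "card (nbrs E u S) \<noteq> 1" if u: "u \<in> V - S - {j}" for u
        proof
          assume "card (nbrs E u S) = 1"
          then obtain a where a: "nbrs E u S = {a}" by (auto simp: card_1_singleton_iff)
          then have "x a = 0" using zero[OF u] by simp
          moreover have "a \<in> S" using a nbrs_subset[of E u S] by auto
          ultimately show False by (simp add: S_def)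
        qed
        then have "A2 E"
          unfolding A2_def sealed_def using True x(1,2) SV by (intro exI[of _ S]) (auto simp: S_def)
        then show False using neg by simp
      next
        case False
        have "\<forall>v\<in>S. x v \<noteq> 0" by (simp add: S_def)
        then have "\<exists>x::'a \<Rightarrow> real. (\<forall>v\<in>S. x v \<noteq> 0) \<and> (\<forall>u\<in>V - S - {j}. sum x (nbrs E u S) = 0)"
          using zero by blast
        then have "A3 E"
          unfolding A3_def using False x(3) SV by (intro exI[of _ S]) (auto simp: S_def)
        then show False using neg by simp
      qed
    qed
    have "EE p (pairs V) (\<lambda>E. ind (exceptional E V j)) \<le> EE p (pairs V) (\<lambda>E. ind (A1 E) + (ind (A2 E) + ind (A3 E)))"
    proof (rule EE_mono)
      fix E
      show "ind (exceptional E V j) \<le> ind (A1 E) + (ind (A2 E) + ind (A3 E))"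
        using split[of E] by (cases "exceptional E V j") auto
    qed (use p p0 in auto)
    also have "\<dots> \<le> exp 1 / d + (1 / d + 64 / d)"
      unfolding EE_add
    proof (intro add_mono)
      have "EE p (pairs V) (\<lambda>E. ind (A1 E)) = (1 - p) ^ (card V - 1)"
        unfolding A1_def by (rule prob_isolated[OF V j])
      also have "\<dots> \<le> exp (- p) ^ (card V - 1)"
        using p exp_ge_add_one_self[of "- p"] by (intro power_mono) auto
      also have "\<dots> = exp (real (card V - 1) * (- p))" by (simp only: exp_of_nat_mult)
      also have "\<dots> \<le> exp (1 - d)"
        using N2 p by (simp add: d_def of_nat_diff algebra_simps)
      also have "\<dots> = exp 1 / exp d" by (simp add: exp_diff)
      also have "\<dots> \<le> exp 1 / d"
      proof -
        have "d \<le> exp d" using exp_ge_add_one_self[of d] by linarith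
        then show ?thesis using d4 by (intro divide_left_mono) auto
      qed
      finally show "EE p (pairs V) (\<lambda>E. ind (A1 E)) \<le> exp 1 / d" .
      show "EE p (pairs V) (\<lambda>E. ind (A2 E)) \<le> 1 / d"
        unfolding A2_def d_def by (rule sealed_le[OF V p dV NV])
      have "EE p (pairs V) (\<lambda>E. ind (A3 E)) \<le> 64 / card V"
        unfolding A3_def by (rule prob_medium_support_kernel_le[OF V N2 p0 p])
      also have "\<dots> \<le> 64 / d" using dN d4 by (intro divide_left_mono) auto
      finally show "EE p (pairs V) (\<lambda>E. ind (A3 E)) \<le> 64 / d" .
    qed
    also have "\<dots> \<le> 70 / d" using d4 exp_le by (simp add: divide_simps)
    finally show ?thesis by (simp add: d_def)
  qed
  then show ?thesis using d0 by blast
qed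

section \<open>Singularity\<close>

definition column_dependent :: "'a set set \<Rightarrow> 'a set \<Rightarrow> 'a \<Rightarrow> bool" where
  "column_dependent E W v \<longleftrightarrow> (\<exists>x::'a \<Rightarrow> real. (\<forall>u\<in>W. sum x (nbrs E u W) = 0) \<and> x v \<noteq> 0)"

text \<open>\<open>\<alpha>\<close> is the neighbourhood of a new vertex: its column is the
  combination \<open>y\<close> of the old columns, and its zero diagonal entry forces
  \<open>sum y \<alpha> = 0\<close>. The graph \<open>B\<close> is fixed here, only
  \<open>\<alpha>\<close> is random.\<close>

lemma prob_new_column_dependent_le:
  fixes p :: real
  assumes V: "finite V" and B: "B \<subseteq> pairs V" and p: "0 < p" "p \<le> 1 / 2"
    and d: "9 \<le> p * card V"
    and few: "8 * card {j \<in> V. exceptional B V j} \<le> card V"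
  shows "(EE p V (\<lambda>\<alpha>. ind (\<exists>y::'a \<Rightarrow> real. (\<forall>u\<in>V. sum y (nbrs B u V) = ind (u \<in> \<alpha>)) \<and> sum y \<alpha> = 0)))\<^sup>2
    \<le> 108 / sqrt (p * card V)"
proof -
  define N where "N = card V"
  define U where "U = nonisolated B V"
  define b where "b u w = ind ({u, w} \<in> B)" for u w
  have UV: "U \<subseteq> V" by (auto simp: U_def nonisolated_def)
  have finU: "finite U" using UV V finite_subset by blast
  have bsym: "b u w = b w u" for u w by (simp add: b_def insert_commute)
  have boff: "b u w = 0" if "w \<notin> U" "u \<in> V" "w \<in> V" for u w
    using that by (auto simp: b_def U_def nonisolated_def)
  have nb: "sum y (nbrs B u V) = (\<Sum>w\<in>V. b u w * y w)" for y :: "'a \<Rightarrow> real" and u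
    unfolding nbrs_def b_def using V
    by (simp add: sum.inter_filter of_bool_def if_distrib[of "\<lambda>t. t * _"] cong: if_cong)
  have adj: "(\<Sum>u\<in>V. x u * (\<Sum>w\<in>V. b u w * y w)) = (\<Sum>w\<in>V. y w * (\<Sum>u\<in>V. b w u * x u))"
    for x y :: "'a \<Rightarrow> real"
  proof -
    have "(\<Sum>u\<in>V. x u * (\<Sum>w\<in>V. b u w * y w)) = (\<Sum>w\<in>V. \<Sum>u\<in>V. x u * (b u w * y w))"
      unfolding sum_distrib_left by (rule sum.swap)
    also have "\<dots> = (\<Sum>w\<in>V. y w * (\<Sum>u\<in>V. b w u * x u))"
      unfolding sum_distrib_left by (intro sum.cong refl) (simp add: bsym mult_ac)
    finally show ?thesis .
  qed
  have indsum: "(\<Sum>u\<in>V. x u * ind (u \<in> \<alpha>)) = sum x \<alpha>" if "\<alpha> \<subseteq> V" for x :: "'a \<Rightarrow> real" and \<alpha>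
    using V that by (simp add: of_bool_def sum.If_cases Int_absorb1 if_distrib[of "\<lambda>t. _ * t"] Int_def[symmetric] cong: if_cong)
  have N18: "N \<ge> 18"
  proof -
    have "p * N \<le> 1 / 2 * N" using p by (intro mult_right_mono) auto
    then show ?thesis using d by (simp add: N_def)
  qed
  have p01: "0 \<le> p" "p \<le> 1" using p by auto
  let ?ev = "\<lambda>\<alpha>. \<exists>y::'a \<Rightarrow> real. (\<forall>u\<in>V. sum y (nbrs B u V) = ind (u \<in> \<alpha>)) \<and> sum y \<alpha> = 0"
  have ev0: "0 \<le> EE p V (\<lambda>\<alpha>. ind (?ev \<alpha>))" by (rule EE_nonneg[OF p01]) simp
  show ?thesis
  proof (cases "\<exists>z::'a \<Rightarrow> real. {v \<in> V. z v \<noteq> 0} \<noteq> {} \<and> {v \<in> V. z v \<noteq> 0} \<subseteq> U \<and> (\<forall>u\<in>V. sum z (nbrs B u V) = 0)")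
    case True
    then obtain z :: "'a \<Rightarrow> real" where z: "{v \<in> V. z v \<noteq> 0} \<noteq> {}" "{v \<in> V. z v \<noteq> 0} \<subseteq> U"
      "\<forall>u\<in>V. sum z (nbrs B u V) = 0" by blast
    have "{j \<in> V. exceptional B V j} \<noteq> V" using few N18 by (auto simp: N_def)
    then obtain j where "j \<in> V" "\<not> exceptional B V j" by blast
    then have big: "4 * card {v \<in> V. z v \<noteq> 0} \<ge> N"
      using z unfolding exceptional_def N_def U_def by (meson DiffD1 not_le)
    \<comment> \<open>By symmetry a kernel vector is orthogonal to everything in the image of
      \<open>B\<close>, in particular to the indicator of \<open>\<alpha>\<close>.\<close>
    have "sum z \<alpha> = 0" if "?ev \<alpha>" and \<alpha>: "\<alpha> \<subseteq> V" for \<alpha>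
    proof -
      from that(1) obtain y :: "'a \<Rightarrow> real" where y: "\<forall>u\<in>V. sum y (nbrs B u V) = ind (u \<in> \<alpha>)" by blast
      have "sum z \<alpha> = (\<Sum>u\<in>V. z u * (\<Sum>w\<in>V. b u w * y w))"
        unfolding indsum[OF \<alpha>, symmetric] using y nb by (intro sum.cong) auto
      also have "\<dots> = (\<Sum>w\<in>V. y w * (\<Sum>u\<in>V. b w u * z u))" by (rule adj)
      also have "\<dots> = 0" using z(3) nb by (intro sum.neutral) simp
      finally show ?thesis .
    qed
    then have "EE p V (\<lambda>\<alpha>. ind (?ev \<alpha>)) \<le> EE p V (\<lambda>\<alpha>. ind (sum z \<alpha> = 0))"
      by (intro EE_mono[OF p01]) (simp only: of_bool_less_eq_iff, blast)
    also have "\<dots> \<le> 9 / sqrt (N / 4 * p)"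
      using big N18 by (intro littlewood_offord[OF V _ _ p]) auto
    finally have "(EE p V (\<lambda>\<alpha>. ind (?ev \<alpha>)))\<^sup>2 \<le> (9 / sqrt (N / 4 * p))\<^sup>2"
      using ev0 by (rule power_mono)
    also have "\<dots> = 324 / (p * N)" using p by (simp add: power_divide)
    \<comment> \<open>Since \<open>sqrt (p * N) \<ge> 3\<close>, the square of the linear bound
      stays below the bound of the quadratic case.\<close>
    also have "\<dots> \<le> 108 / sqrt (p * N)"
    proof -
      have "3 \<le> sqrt (p * N)" using d by (intro real_le_rsqrt) (simp add: N_def)
      moreover have "324 / (r * r) \<le> 108 / r" if "3 \<le> r" for r :: real
        using that by (simp add: field_simps)
      ultimately have "324 / (sqrt (p * N) * sqrt (p * N)) \<le> 108 / sqrt (p * N)" by blast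
      then show ?thesis using p by simp
    qed
    finally show ?thesis by (simp add: N_def)
  next
    case False
    \<comment> \<open>\<open>x\<close> is column \<open>k\<close> of the inverse of \<open>B\<close>
      on \<open>U\<close>, extended by zero. An obstruction to solvability, restricted to
      \<open>U\<close>, would be a kernel vector of the kind excluded in this case.\<close>
    have "\<exists>x::'a \<Rightarrow> real. (\<forall>v. v \<notin> U \<longrightarrow> x v = 0) \<and> (\<forall>u\<in>V. (\<Sum>w\<in>V. b u w * x w) = ind (u = k))"
      if k: "k \<in> U" for k
      using fredholm_alternative[OF finU V, of b "\<lambda>u. ind (u = k)"]
    proof (elim disjE exE conjE)
      fix x assume x: "\<forall>i\<in>V. (\<Sum>j\<in>U. b i j * x j) = ind (i = k)"
      define x' where "x' v = (if v \<in> U then x v else 0)" for v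
      have "(\<Sum>w\<in>V. b u w * x' w) = (\<Sum>j\<in>U. b u j * x j)" for u
        using V UV by (intro sum.mono_neutral_cong_right) (auto simp: x'_def)
      then show ?thesis using x by (intro exI[of _ x']) (auto simp: x'_def)
    next
      fix y assume y: "\<forall>j\<in>U. (\<Sum>i\<in>V. y i * b i j) = 0" "(\<Sum>i\<in>V. y i * ind (i = k)) \<noteq> 0"
      define z where "z v = (if v \<in> U then y v else 0)" for v
      have "(\<Sum>i\<in>V. y i * ind (i = k)) = y k"
        using indsum[of "{k}" y] k UV by auto
      then have "z k \<noteq> 0" using y(2) k by (simp add: z_def)
      moreover have "sum z (nbrs B u V) = 0" if u: "u \<in> V" for u
      proof -
        have "sum z (nbrs B u V) = (\<Sum>i\<in>V. y i * b i u)"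
          unfolding nb
        proof (rule sum.cong[OF refl])
          fix i assume "i \<in> V"
          then show "b u i * z i = y i * b i u"
            using boff[of i u] bsym[of u i] u by (cases "i \<in> U") (simp_all add: z_def)
        qed
        also have "\<dots> = 0"
        proof (cases "u \<in> U")
          case False
          then show ?thesis using boff u by (intro sum.neutral) auto
        qed (use y in auto)
        finally show ?thesis .
      qed
      moreover have "{v \<in> V. z v \<noteq> 0} \<subseteq> U" by (auto simp: z_def)
      ultimately show ?thesis using False k UV by blast
    qed
    then obtain w :: "'a \<Rightarrow> 'a \<Rightarrow> real" where w: "\<And>k v. k \<in> U \<Longrightarrow> v \<notin> U \<Longrightarrow> w k v = 0"
      "\<And>k u. k \<in> U \<Longrightarrow> u \<in> V \<Longrightarrow> (\<Sum>v\<in>V. b u v * w k v) = ind (u = k)" by metis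
    have wsym: "w k i = w i k" if ik: "i \<in> U" "k \<in> U" for i k
    proof -
      have ikV: "i \<in> V" "k \<in> V" using ik UV by auto
      have "w k i = (\<Sum>u\<in>V. w k u * (\<Sum>v\<in>V. b u v * w i v))"
        using indsum[of "{i}" "w k"] ik ikV by (simp add: w(2))
      also have "\<dots> = (\<Sum>v\<in>V. w i v * (\<Sum>u\<in>V. b v u * w k u))" by (rule adj)
      also have "\<dots> = w i k"
        using indsum[of "{k}" "w i"] ik ikV by (simp add: w(2))
      finally show ?thesis .
    qed
    define good where "good = {j \<in> V. \<not> exceptional B V j}"
    have goodU: "good \<subseteq> U" by (auto simp: good_def exceptional_def U_def)
    have gsupp: "N \<le> 4 * card {v \<in> V. w k v \<noteq> 0}" if k: "k \<in> good" for k
    proof (rule ccontr)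
      assume "\<not> N \<le> 4 * card {v \<in> V. w k v \<noteq> 0}"
      moreover have kU: "k \<in> U" using k goodU by blast
      moreover have "{v \<in> V. w k v \<noteq> 0} \<noteq> {}"
      proof
        assume "{v \<in> V. w k v \<noteq> 0} = {}"
        then have "(\<Sum>v\<in>V. b k v * w k v) = 0" by (intro sum.neutral) auto
        then show False using w(2)[OF kU, of k] kU UV by auto
      qed
      moreover have "{v \<in> V. w k v \<noteq> 0} \<subseteq> U" using w(1)[OF kU] by auto
      moreover have "\<forall>u\<in>V - {k}. sum (w k) (nbrs B u V) = 0"
        using w(2)[OF kU] by (auto simp: nb)
      ultimately have "exceptional B V k" unfolding exceptional_def N_def U_def by (intro disjI2 exI[of _ "w k"]) auto
      then show False using k by (simp add: good_def)
    qed
    have "good \<union> {j \<in> V. exceptional B V j} = V" by (auto simp: good_def)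
    moreover have "card (good \<union> {j \<in> V. exceptional B V j}) = card good + card {j \<in> V. exceptional B V j}"
      by (rule card_Un_disjoint) (use V in \<open>auto simp: good_def\<close>)
    ultimately have "N div 8 \<le> card good" using few by (simp add: N_def)
    then obtain J where J: "J \<subseteq> good" "card J = N div 8" "finite J"
      by (rule obtain_subset_with_card_n)
    have JU: "J \<subseteq> U" using J(1) goodU by blast
    have Jne: "J \<noteq> {}" using J(2) N18 by auto
    \<comment> \<open>A good column of the inverse has at least \<open>N / 4\<close> nonzero
      entries, of which at most \<open>card J \<le> N / 8\<close> lie in \<open>J\<close>; hence the
      size \<open>N div 8\<close> of \<open>J\<close>.\<close>
    have nz: "real N / 8 \<le> card {i \<in> U - J. w j i \<noteq> 0}" if "j \<in> J" for j
    proof -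
      have jU: "j \<in> U" using that JU by blast
      have "{v \<in> V. w j v \<noteq> 0} \<subseteq> {i \<in> U - J. w j i \<noteq> 0} \<union> J"
        using w(1)[OF jU] by auto
      then have "card {v \<in> V. w j v \<noteq> 0} \<le> card ({i \<in> U - J. w j i \<noteq> 0} \<union> J)"
        using finU J(3) by (intro card_mono) auto
      also have "\<dots> \<le> card {i \<in> U - J. w j i \<noteq> 0} + card J" by (rule card_Un_le)
      finally have "N \<le> 4 * (card {i \<in> U - J. w j i \<noteq> 0} + N div 8)"
        using gsupp[of j] that J(1,2) by fastforce
      moreover have "8 * (N div 8) \<le> N" by simp
      moreover have "n \<le> 8 * c" if "n \<le> 4 * (c + m)" "8 * m \<le> n" for n c m :: nat
        using that by simp
      ultimately have "N \<le> 8 * card {i \<in> U - J. w j i \<noteq> 0}" by blast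
      then show ?thesis by linarith
    qed
    define Q where "Q F = (\<Sum>i\<in>F. \<Sum>j\<in>F. w j i)" for F
    have Q0: "Q (\<alpha> \<inter> U) = 0" if "?ev \<alpha>" and \<alpha>: "\<alpha> \<subseteq> V" for \<alpha>
    proof -
      from that(1) obtain y :: "'a \<Rightarrow> real" where y: "\<And>u. u \<in> V \<Longrightarrow> (\<Sum>w\<in>V. b u w * y w) = ind (u \<in> \<alpha>)"
        and y0: "sum y \<alpha> = 0" unfolding nb by blast
      \<comment> \<open>The row of \<open>B\<close> at an isolated vertex is zero, so solvability
        keeps such vertices out of \<open>\<alpha>\<close>.\<close>
      have "\<alpha> \<subseteq> U"
      proof
        fix u assume u: "u \<in> \<alpha>"
        show "u \<in> U"
        proof (rule ccontr)
          assume "u \<notin> U"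
          then have "b u w = 0" if "w \<in> V" for w
            using boff[of u w] bsym[of u w] u \<alpha> that by auto
          then have "(\<Sum>w\<in>V. b u w * y w) = 0" by simp
          then show False using y[of u] u \<alpha> by auto
        qed
      qed
      \<comment> \<open>\<open>x\<close> is the inverse applied to \<open>\<alpha>\<close>. The
        solution \<open>y\<close> may differ from it at isolated vertices, but symmetry of
        \<open>B\<close> gives \<open>sum x \<alpha> = sum y \<alpha>\<close>.\<close>
      define x where "x i = (\<Sum>k\<in>\<alpha>. w k i)" for i
      have bx: "(\<Sum>u\<in>V. b v u * x u) = ind (v \<in> \<alpha>)" if "v \<in> V" for v
      proof -
        have "(\<Sum>u\<in>V. b v u * x u) = (\<Sum>k\<in>\<alpha>. \<Sum>u\<in>V. b v u * w k u)"
          unfolding x_def sum_distrib_left by (rule sum.swap)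
        also have "\<dots> = (\<Sum>k\<in>\<alpha>. ind (v = k))"
          using w(2) \<open>\<alpha> \<subseteq> U\<close> that by (intro sum.cong) auto
        also have "\<dots> = ind (v \<in> \<alpha>)"
          using finite_subset[OF \<alpha> V] by (simp add: of_bool_def)
        finally show ?thesis .
      qed
      have "Q \<alpha> = sum x \<alpha>" by (simp add: Q_def x_def)
      also have "\<dots> = (\<Sum>u\<in>V. x u * (\<Sum>w\<in>V. b u w * y w))"
        unfolding indsum[OF \<alpha>, symmetric] using y by (intro sum.cong) auto
      also have "\<dots> = (\<Sum>v\<in>V. y v * (\<Sum>u\<in>V. b v u * x u))" by (rule adj)
      also have "\<dots> = (\<Sum>v\<in>V. y v * ind (v \<in> \<alpha>))" using bx by (intro sum.cong) auto
      also have "\<dots> = 0" unfolding indsum[OF \<alpha>] by (rule y0)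
      finally show ?thesis using \<open>\<alpha> \<subseteq> U\<close> by (simp add: Int_absorb2)
    qed
    have "EE p V (\<lambda>\<alpha>. ind (?ev \<alpha>)) \<le> EE p V (\<lambda>\<alpha>. ind (Q (\<alpha> \<inter> U) = 0))"
      using Q0 by (intro EE_mono[OF p01]) (simp only: of_bool_less_eq_iff, blast)
    also have "\<dots> = EE p U (\<lambda>\<alpha>. ind (Q (\<alpha> \<inter> U) = 0))"
      using V UV by (intro EE_marginal) auto
    also have "\<dots> = EE p U (\<lambda>\<alpha>. ind (Q \<alpha> = 0))"
      by (intro EE_cong) (simp add: Int_absorb2)
    finally have "(EE p V (\<lambda>\<alpha>. ind (?ev \<alpha>)))\<^sup>2 \<le> (EE p U (\<lambda>\<alpha>. ind (Q \<alpha> = 0)))\<^sup>2"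
      using ev0 by (rule power_mono)
    also have "\<dots> \<le> 18 / sqrt (N / 8 * p) + 9 / sqrt (card J / 2 * p)"
      unfolding Q_def using wsym nz N18 by (intro quadratic_littlewood_offord[OF finU JU Jne p]) auto
    also have "\<dots> \<le> 18 / sqrt (N / 8 * p) + 9 / sqrt (N / 32 * p)"
    proof -
      have "real N / 16 \<le> real (card J)" unfolding J(2) using N18 by linarith
      then show ?thesis using N18 p
        by (intro add_left_mono divide_left_mono real_sqrt_le_mono mult_right_mono mult_pos_pos) auto
    qed
    \<comment> \<open>Both summands equal \<open>36 * sqrt 2 / sqrt (p * N)\<close>.\<close>
    also have "\<dots> = 72 * sqrt 2 / sqrt (p * N)"
    proof -
      have s: "sqrt 8 = 2 * sqrt (2::real)" "sqrt 32 = 4 * sqrt (2::real)"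
        using real_sqrt_mult[of 4 2] real_sqrt_mult[of 16 2] real_sqrt_unique[of 4 16] by simp_all
      have e: "sqrt (N / 8 * p) = sqrt (p * N) / (2 * sqrt 2)" "sqrt (N / 32 * p) = sqrt (p * N) / (4 * sqrt 2)"
        unfolding s[symmetric] by (simp_all add: mult.commute flip: real_sqrt_divide)
      show ?thesis unfolding e by (simp add: add_divide_distrib[symmetric])
    qed
    also have "\<dots> \<le> 108 / sqrt (p * N)"
    proof -
      have "sqrt 2 \<le> 3 / (2::real)" by (rule real_le_lsqrt) (auto simp: power2_eq_square)
      then show ?thesis using p by (intro divide_right_mono) auto
    qed
    finally show ?thesis by (simp add: N_def)
  qed
qed

text \<open>Expose the graph \<open>B\<close> on \<open>V\<close> first, then the edges at
  \<open>v\<close>. Markov's inequality for the number of exceptional vertices of \<open>B\<close>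
  bounds the probability of more than \<open>card V / 8\<close> of them by
  \<open>8 * \<beta>\<close>; otherwise the bound for a new column applies.\<close>

lemma prob_column_dependent_le:
  fixes p \<beta> :: real
  assumes V: "finite V" and v: "v \<notin> V" and p: "0 < p" "p \<le> 1 / 2" and d: "9 \<le> p * card V"
    and \<beta>: "\<And>j. j \<in> V \<Longrightarrow> EE p (pairs V) (\<lambda>E. ind (exceptional E V j)) \<le> \<beta>"
  shows "EE p (pairs (insert v V)) (\<lambda>E. ind (column_dependent E (insert v V) v))
    \<le> 8 * \<beta> + sqrt (108 / sqrt (p * card V))"
proof -
  define N where "N = real (card V)"
  let ?W = "insert v V"
  have p01: "0 \<le> p" "p \<le> 1" using p by auto
  have N0: "N > 0" using d by (cases "card V = 0") (auto simp: N_def)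
  have dec: "pairs ?W = pairs V \<union> star v V"
  proof
    show "pairs ?W \<subseteq> pairs V \<union> star v V"
    proof
      fix e assume "e \<in> pairs ?W"
      then have e: "e \<subseteq> ?W" "card e = 2" by (auto simp: pairs_def)
      show "e \<in> pairs V \<union> star v V"
      proof (cases "v \<in> e")
        case True
        then obtain w where "e = {v, w}" "w \<noteq> v" using e(2) by (auto simp: card_2_iff)
        then show ?thesis using e(1) by (auto simp: star_def)
      qed (use e in \<open>auto simp: pairs_def\<close>)
    qed
    show "pairs V \<union> star v V \<subseteq> pairs ?W"
      using v by (intro Un_least pairs_mono star_subset_pairs) auto
  qed
  define few where "few B \<longleftrightarrow> 8 * card {j \<in> V. exceptional B V j} \<le> card V" for B
  define ev where "ev B \<alpha> \<longleftrightarrow> (\<exists>y::'a \<Rightarrow> real. (\<forall>u\<in>V. sum y (nbrs B u V) = ind (u \<in> \<alpha>)) \<and> sum y \<alpha> = 0)" for B \<alpha>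
  let ?st = "\<lambda>\<alpha>. (\<lambda>w. {v, w}) ` \<alpha>"
  have dep: "ev B \<alpha>" if B: "B \<subseteq> pairs V" and \<alpha>: "\<alpha> \<subseteq> V" and dp: "column_dependent (B \<union> ?st \<alpha>) ?W v" for B \<alpha>
  proof -
    obtain x :: "'a \<Rightarrow> real" where x: "\<And>u. u \<in> ?W \<Longrightarrow> sum x (nbrs (B \<union> ?st \<alpha>) u ?W) = 0" "x v \<noteq> 0"
      using dp unfolding column_dependent_def by blast
    have vB: "{v, w} \<notin> B" "{w, v} \<notin> B" for w
      using B v pair_in_pairs_iff[of v w V] pair_in_pairs_iff[of w v V] by blast+
    have "nbrs (B \<union> ?st \<alpha>) v ?W = \<alpha>"
      using \<alpha> vB by (auto simp: nbrs_def doubleton_eq_iff)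
    then have s\<alpha>: "sum x \<alpha> = 0" using x(1)[of v] by simp
    have nu: "nbrs (B \<union> ?st \<alpha>) u ?W = nbrs B u V \<union> (if u \<in> \<alpha> then {v} else {})" if "u \<in> V" for u
      using that \<alpha> vB v by (auto simp: nbrs_def doubleton_eq_iff split: if_splits)
    \<comment> \<open>Scaling the coefficient of \<open>v\<close> to -1 expresses the column of
      \<open>v\<close> by the other ones.\<close>
    define y where "y w = - x w / x v" for w
    have sy: "sum y T = - sum x T / x v" for T
      unfolding y_def by (simp add: sum_negf flip: sum_divide_distrib)
    have "sum y (nbrs B u V) = ind (u \<in> \<alpha>)" if u: "u \<in> V" for u
    proof -
      have "v \<notin> nbrs B u V" using v nbrs_subset[of B u V] by auto
      then have "sum x (nbrs (B \<union> ?st \<alpha>) u ?W) = sum x (nbrs B u V) + (if u \<in> \<alpha> then x v else 0)"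
        unfolding nu[OF u] using V by simp
      then have "sum x (nbrs B u V) = - (if u \<in> \<alpha> then x v else 0)" using x(1)[of u] u by simp
      then show ?thesis using x(2) by (simp add: sy)
    qed
    moreover have "sum y \<alpha> = 0" using s\<alpha> by (simp add: sy)
    ultimately show ?thesis unfolding ev_def by blast
  qed
  let ?R = "sqrt (108 / sqrt (p * card V))"
  have fixB: "EE p V (\<lambda>\<alpha>. ind (ev B \<alpha>)) \<le> ind (\<not> few B) + ?R" if B: "B \<subseteq> pairs V" for B
  proof (cases "few B")
    case True
    have "(EE p V (\<lambda>\<alpha>. ind (ev B \<alpha>)))\<^sup>2 \<le> 108 / sqrt (p * card V)"
      unfolding ev_def using True by (intro prob_new_column_dependent_le[OF V B p d]) (simp add: few_def)
    then show ?thesis using True real_le_rsqrt by simp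
  next
    case False
    have "EE p V (\<lambda>\<alpha>. ind (ev B \<alpha>)) \<le> EE p V (\<lambda>_. 1)" by (rule EE_mono[OF p01]) simp
    moreover have "EE p V (\<lambda>_. 1) = 1" "0 \<le> ?R" using V p by simp_all
    moreover have "ind (\<not> few B) = (1 :: real)" using False by simp
    ultimately show ?thesis by linarith
  qed
  have "EE p (pairs ?W) (\<lambda>E. ind (column_dependent E ?W v)) =
      EE p (pairs V) (\<lambda>B. EE p (star v V) (\<lambda>G. ind (column_dependent (B \<union> G) ?W v)))"
    unfolding dec using V v
    by (intro EE_union) (auto simp: star_def pair_in_pairs_iff)
  also have "\<dots> = EE p (pairs V) (\<lambda>B. EE p V (\<lambda>\<alpha>. ind (column_dependent (B \<union> ?st \<alpha>) ?W v)))"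
    unfolding star_def by (subst EE_reindex[OF inj_on_pair]) simp
  also have "\<dots> \<le> EE p (pairs V) (\<lambda>B. EE p V (\<lambda>\<alpha>. ind (ev B \<alpha>)))"
    using dep by (intro EE_mono[OF p01]) (simp only: of_bool_less_eq_iff, blast)
  also have "\<dots> \<le> EE p (pairs V) (\<lambda>B. ind (\<not> few B) + ?R)"
    by (intro EE_mono[OF p01] fixB)
  also have "\<dots> = EE p (pairs V) (\<lambda>B. ind (\<not> few B)) + ?R"
    using V by (simp add: EE_add)
  also have "EE p (pairs V) (\<lambda>B. ind (\<not> few B)) \<le> EE p (pairs V) (\<lambda>B. 8 / N * (\<Sum>j\<in>V. ind (exceptional B V j)))"
  proof (rule EE_mono[OF p01])
    fix B
    have "(\<Sum>j\<in>V. ind (exceptional B V j)) = real (card {j \<in> V. exceptional B V j})"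
      using V by (simp add: Int_def)
    then show "ind (\<not> few B) \<le> 8 / N * (\<Sum>j\<in>V. ind (exceptional B V j))"
      using N0 by (auto simp: few_def N_def field_simps)
  qed
  also have "\<dots> = 8 / N * (\<Sum>j\<in>V. EE p (pairs V) (\<lambda>B. ind (exceptional B V j)))"
    by (simp only: EE_cmult EE_sum)
  also have "\<dots> \<le> 8 / N * (\<Sum>j\<in>V. \<beta>)"
    using N0 by (intro mult_left_mono sum_mono \<beta>) auto
  also have "\<dots> = 8 * \<beta>" using N0 by (simp add: N_def)
  finally show ?thesis by simp
qed

text \<open>Isolated vertices always contribute kernel vectors. Restricting the support to
  nonisolated vertices leaves those that push the rank below n - i(G).\<close>

definition singular :: "'a set set \<Rightarrow> 'a set \<Rightarrow> bool" where
  "singular E V \<longleftrightarrow> (\<exists>x::'a \<Rightarrow> real. {v \<in> V. x v \<noteq> 0} \<noteq> {} \<and> {v \<in> V. x v \<noteq> 0} \<subseteq> nonisolated E V \<and>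
    (\<forall>u\<in>V. sum x (nbrs E u V) = 0))"

text \<open>A kernel vector with at least \<open>card V / 4\<close> nonzero entries makes a quarter of the columns
  dependent on the other ones.\<close>

lemma prob_singular_le:
  fixes p \<beta> :: real
  assumes V: "finite V" "j \<in> V" and p: "0 \<le> p" "p \<le> 1"
    and \<beta>: "\<And>v. v \<in> V \<Longrightarrow> EE p (pairs V) (\<lambda>E. ind (column_dependent E V v)) \<le> \<beta>"
  shows "EE p (pairs V) (\<lambda>E. ind (singular E V)) \<le> EE p (pairs V) (\<lambda>E. ind (exceptional E V j)) + 4 * \<beta>"
proof -
  define N where "N = real (card V)"
  have N0: "N > 0" using V by (auto simp: N_def card_gt_0_iff)
  have "EE p (pairs V) (\<lambda>E. ind (singular E V))
    \<le> EE p (pairs V) (\<lambda>E. ind (exceptional E V j) + 4 / N * (\<Sum>v\<in>V. ind (column_dependent E V v)))"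
  proof (rule EE_mono[OF p])
    fix E
    have nonneg: "0 \<le> 4 / N * (\<Sum>v\<in>V. ind (column_dependent E V v))"
      using N0 by (intro mult_nonneg_nonneg sum_nonneg) auto
    show "ind (singular E V) \<le> ind (exceptional E V j) + 4 / N * (\<Sum>v\<in>V. ind (column_dependent E V v))"
    proof (cases "singular E V \<and> \<not> exceptional E V j")
      case False
      then show ?thesis using nonneg by auto
    next
      case True
      then obtain x :: "'a \<Rightarrow> real" where x: "{v \<in> V. x v \<noteq> 0} \<noteq> {}" "{v \<in> V. x v \<noteq> 0} \<subseteq> nonisolated E V"
        "\<forall>u\<in>V. sum x (nbrs E u V) = 0" unfolding singular_def by blast
      have "card V \<le> 4 * card {v \<in> V. x v \<noteq> 0}"
      proof (rule ccontr)
        assume "\<not> card V \<le> 4 * card {v \<in> V. x v \<noteq> 0}"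
        then have "exceptional E V j" unfolding exceptional_def using x by (intro disjI2 exI[of _ x]) auto
        then show False using True by simp
      qed
      also have "card {v \<in> V. x v \<noteq> 0} \<le> card {v \<in> V. column_dependent E V v}"
        unfolding column_dependent_def using V x(3) by (intro card_mono) auto
      finally have "N \<le> 4 * (\<Sum>v\<in>V. ind (column_dependent E V v))"
        using V by (simp add: N_def Int_def)
      then show ?thesis using N0 by (simp add: field_simps)
    qed
  qed
  also have "\<dots> = EE p (pairs V) (\<lambda>E. ind (exceptional E V j)) + 4 / N * (\<Sum>v\<in>V. EE p (pairs V) (\<lambda>E. ind (column_dependent E V v)))"
    by (simp only: EE_add EE_cmult EE_sum)
  also have "\<dots> \<le> EE p (pairs V) (\<lambda>E. ind (exceptional E V j)) + 4 / N * (\<Sum>v\<in>V. \<beta>)"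
    using N0 by (intro add_left_mono mult_left_mono sum_mono \<beta>) auto
  also have "\<dots> = EE p (pairs V) (\<lambda>E. ind (exceptional E V j)) + 4 * \<beta>"
    using N0 by (simp add: N_def)
  finally show ?thesis .
qed

section \<open>Rank of the matrix and probability in the random graph\<close>

text \<open>The columns of isolated vertices are zero, and a relation between the other columns is a
  kernel vector supported on nonisolated vertices. So the latter columns form a maximal independent
  set of columns.\<close>

lemma rank_adjacency_matrix:
  assumes E: "E \<subseteq> vertex_pairs n" and ns: "\<not> singular E {1..n}"
  shows "vec_space.rank n (adjacency_matrix n E) = n - num_isolated n E"
proof -
  interpret vec_space "TYPE(real)" n .
  define V where "V = {1..n}"
  define A where "A = adjacency_matrix n E"
  define U where "U = {i. i < n \<and> Suc i \<in> nonisolated E V}"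
  have A: "A \<in> carrier_mat n n" by (simp add: A_def adjacency_matrix_def)
  have colv: "col A i \<in> carrier_vec n" for i using A by (metis carrier_matD(1) col_dim)
  have entry: "col A i $ r = ind ({Suc r, Suc i} \<in> E)" if "i < n" "r < n" for i r
    using that A by (simp add: A_def adjacency_matrix_def adjacent_def)
  have finV: "finite V" by (simp add: V_def)
  have finU: "finite U" by (simp add: U_def)
  have setcols: "set (cols A) = col A ` {..<n}"
    using A by (auto simp: cols_def)
  have kernel: "\<forall>i\<in>U. y i = 0" if y: "\<And>r. r < n \<Longrightarrow> (\<Sum>i\<in>U. y i * col A i $ r) = 0" for y :: "nat \<Rightarrow> real"
  proof (rule ccontr)
    assume "\<not> (\<forall>i\<in>U. y i = 0)"
    then obtain i where i: "i \<in> U" "y i \<noteq> 0" by blast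
    \<comment> \<open>Column \<open>i\<close> belongs to vertex \<open>Suc i\<close>. At 0 the
      truncated subtraction may give a nonzero value, but 0 is not in \<open>V\<close>.\<close>
    define x where "x v = (if v - 1 \<in> U then y (v - 1) else 0)" for v
    have "Suc i \<in> {v \<in> V. x v \<noteq> 0}" using i by (auto simp: x_def V_def U_def)
    moreover have "{v \<in> V. x v \<noteq> 0} \<subseteq> nonisolated E V"
      by (auto simp: x_def V_def U_def split: if_splits)
    moreover have "sum x (nbrs E u V) = 0" if u: "u \<in> V" for u
    proof -
      have "sum x (nbrs E u V) = (\<Sum>v\<in>V. ind ({u, v} \<in> E) * x v)"
        unfolding nbrs_def using finV by (simp add: sum.inter_filter of_bool_def if_distrib[of "\<lambda>t. t * _"] cong: if_cong)
      also have "\<dots> = (\<Sum>i<n. ind ({u, Suc i} \<in> E) * x (Suc i))"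
        unfolding V_def by (simp add: sum.atLeast1_atMost_eq)
      also have "\<dots> = (\<Sum>i\<in>U. y i * ind ({u, Suc i} \<in> E))"
        by (rule sum.mono_neutral_cong_right) (auto simp: U_def x_def)
      also have "\<dots> = (\<Sum>i\<in>U. y i * col A i $ (u - 1))"
        using u by (intro sum.cong) (auto simp: entry U_def V_def)
      also have "\<dots> = 0" using u by (intro y) (auto simp: V_def)
      finally show ?thesis .
    qed
    ultimately have "singular E V" unfolding singular_def by blast
    then show False using ns by (simp add: V_def)
  qed
  \<comment> \<open>The rank counts a set of columns, in which equal columns would collapse; two
    equal columns would give a kernel vector with entries 1 and -1.\<close>
  have inj: "inj_on (col A) U"
  proof (rule inj_onI, rule ccontr)
    fix i k assume ik: "i \<in> U" "k \<in> U" "col A i = col A k" "i \<noteq> k"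
    define y where "y l = ind (l = i) - ind (l = k)" for l :: nat
    have "(\<Sum>l\<in>U. y l * col A l $ r) = 0" for r
    proof -
      have "(\<Sum>l\<in>U. y l * col A l $ r) = (\<Sum>l\<in>{i, k}. y l * col A l $ r)"
        using ik finU by (intro sum.mono_neutral_right) (auto simp: y_def)
      then show ?thesis using ik by (simp add: y_def)
    qed
    then have "y i = 0" using kernel[of y] ik(1) by blast
    then show False using ik(4) by (simp add: y_def)
  qed
  have indpt: "lin_indpt (col A ` U)"
  proof
    assume "lin_dep (col A ` U)"
    then obtain S a c where S: "S \<subseteq> col A ` U" "lincomb a S = 0\<^sub>v n" "c \<in> S" "a c \<noteq> 0"
      unfolding lin_dep_def by auto
    define y where "y i = (if col A i \<in> S then a (col A i) else 0)" for i
    have "(\<Sum>i\<in>U. y i * col A i $ r) = 0" if r: "r < n" for r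
    proof -
      have "(\<Sum>i\<in>U. y i * col A i $ r) = (\<Sum>c\<in>col A ` U. (if c \<in> S then a c else 0) * c $ r)"
        by (simp add: sum.reindex[OF inj] y_def)
      also have "\<dots> = (\<Sum>c\<in>S. a c * c $ r)"
        using S(1) finU by (intro sum.mono_neutral_cong_right) auto
      also have "\<dots> = lincomb a S $ r"
        by (rule lincomb_index[symmetric, OF r]) (use S(1) colv in auto)
      also have "\<dots> = 0" using S(2) r by simp
      finally show ?thesis .
    qed
    then have "\<forall>i\<in>U. y i = 0" by (rule kernel)
    moreover obtain i where "i \<in> U" "c = col A i" using S(1,3) by blast
    ultimately show False using S(3,4) by (auto simp: y_def)
  qed
  have "maximal (col A ` U) (\<lambda>T. T \<subseteq> set (cols A) \<and> lin_indpt T)"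
    unfolding maximal_def
  proof (intro conjI allI impI)
    show "col A ` U \<subseteq> set (cols A)" unfolding setcols by (auto simp: U_def)
    show "lin_indpt (col A ` U)" by (rule indpt)
    fix T assume T: "col A ` U \<subseteq> T \<and> T \<subseteq> set (cols A) \<and> lin_indpt T"
    have Tc: "T \<subseteq> carrier_vec n" using T setcols colv by auto
    have "T \<subseteq> col A ` U"
    proof
      fix t assume t: "t \<in> T"
      then obtain i where i: "i < n" "t = col A i" using T setcols by auto
      show "t \<in> col A ` U"
      proof (cases "i \<in> U")
        case False
        have "t = 0\<^sub>v n"
        proof (rule eq_vecI)
          fix r assume r: "r < dim_vec (0\<^sub>v n)"
          have "{Suc r, Suc i} \<notin> E" using False i(1) r by (auto simp: U_def nonisolated_def V_def)
          then show "t $ r = 0\<^sub>v n $ r" using i r entry by simp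
        qed (use i A in simp)
        then have "0\<^sub>v n \<in> T" using t by simp
        then have False using zero_nin_lin_indpt[of T] T Tc by auto
        then show ?thesis ..
      qed (use i in simp)
    qed
    then show "T = col A ` U" using T by blast
  qed
  then have "rank A = card (col A ` U)" by (rule rank_card_indpt[OF A])
  also have "\<dots> = card U" by (rule card_image[OF inj])
  also have "\<dots> = card (Suc ` U)" by (simp add: card_image)
  also have "Suc ` U = V - isolated_vertices n E"
  proof -
    have "v \<in> Suc ` U \<longleftrightarrow> v \<in> nonisolated E V" for v
      by (cases v) (auto simp: U_def nonisolated_def V_def)
    moreover have "v \<in> nonisolated E V \<longleftrightarrow> v \<in> V - isolated_vertices n E" for v
      by (auto simp: nonisolated_def V_def isolated_vertices_def adjacent_def insert_commute)
    ultimately show ?thesis by blast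
  qed
  also have "card (V - isolated_vertices n E) = n - num_isolated n E"
    unfolding num_isolated_def V_def
    by (subst card_Diff_subset) (auto simp: isolated_vertices_def intro: finite_subset[of _ "{1..n}"])
  finally show ?thesis by (simp add: A_def)
qed

lemma prob_random_graph:
  assumes p: "0 \<le> p" "p \<le> 1"
  shows "measure_pmf.prob (random_graph n p) X = EE p (pairs {1..n}) (\<lambda>E. ind (E \<in> X))"
proof -
  define A where "A = pairs {1..n}"
  have fin: "finite A" by (simp add: A_def)
  let ?P = "Pi_pmf A False (\<lambda>_. bernoulli_pmf p)"
  have rg: "random_graph n p = map_pmf (\<lambda>f. {e \<in> A. f e}) ?P"
    by (simp add: random_graph_def A_def pairs_def vertex_pairs_def)
  have sub: "set_pmf (random_graph n p) \<subseteq> Pow A" by (auto simp: rg)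
  have point: "pmf (random_graph n p) F = p ^ card F * (1 - p) ^ card (A - F)" if F: "F \<subseteq> A" for F
  proof -
    have "pmf (random_graph n p) F = measure_pmf.prob ?P ((\<lambda>f. {e \<in> A. f e}) -` {F})"
      unfolding rg by (rule pmf_map)
    \<comment> \<open>Functions that differ from the default \<open>False\<close> outside
      \<open>A\<close> have probability 0, which leaves one function for each
      \<open>F\<close>.\<close>
    also have "\<dots> = measure_pmf.prob ?P {\<lambda>e. e \<in> F}"
    proof (rule measure_prob_cong_0)
      fix f assume "f \<in> (\<lambda>f. {e \<in> A. f e}) -` {F} - {\<lambda>e. e \<in> F}"
      then have "{e \<in> A. f e} = F" "f \<noteq> (\<lambda>e. e \<in> F)" by auto
      then obtain e where "e \<notin> A" "f e" by fastforce
      then show "pmf ?P f = 0" using fin by (intro pmf_Pi_outside) auto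
    qed (use F in auto)
    also have "\<dots> = (\<Prod>e\<in>A. pmf (bernoulli_pmf p) (e \<in> F))"
      unfolding measure_pmf_single using F fin by (intro pmf_Pi') auto
    also have "\<dots> = (\<Prod>e\<in>F \<union> (A - F). if e \<in> F then p else 1 - p)"
      using p F by (intro prod.cong) auto
    also have "\<dots> = p ^ card F * (1 - p) ^ card (A - F)"
      using F fin by (subst prod.union_disjoint) (auto intro: finite_subset)
    finally show ?thesis .
  qed
  have "measure_pmf.prob (random_graph n p) X = measure_pmf.prob (random_graph n p) (X \<inter> Pow A)"
    using sub by (intro measure_prob_cong_0) (auto simp: set_pmf_eq)
  also have "\<dots> = (\<Sum>F\<in>X \<inter> Pow A. pmf (random_graph n p) F)"
    using fin by (intro measure_measure_pmf_finite) auto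
  also have "\<dots> = EE p A (\<lambda>E. ind (E \<in> X))"
    unfolding EE_def using fin by (intro sum.mono_neutral_cong_left) (auto simp: point)
  finally show ?thesis by (simp add: A_def)
qed

theorem theorem1p2:
  fixes c :: real
  assumes "c > 1 / 2"
  shows "\<exists>C > 0. \<exists>N. \<forall>n \<ge> N. \<forall>p :: real.
           c * ln (real n) / real n \<le> p \<and> p \<le> 1 / 2 \<longrightarrow>
           measure_pmf.prob (random_graph n p)
             {E. vec_space.rank n (adjacency_matrix n E) = n - num_isolated n E}
           \<ge> 1 - C * ln (ln (real n)) powr (- (1 / 4))"
proof -
  \<comment> \<open>The gap between \<open>c'\<close> and \<open>c\<close> pays for the removal of a
    vertex: \<open>c' * ln n \<le> p * (n - 1)\<close> for large \<open>n\<close>.\<close>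
  define c' where "c' = (c + 1 / 2) / 2"
  have c': "1 / 2 < c'" "c' < c" using assms by (auto simp: c'_def)
  \<comment> \<open>Chosen so that \<open>exp (2 * \<gamma> * L) = n\<close> for
    \<open>L = c' * ln n\<close>.\<close>
  define \<gamma> where "\<gamma> = 1 / (2 * c')"
  have \<gamma>: "\<gamma> < 1" using c' by (simp add: \<gamma>_def field_simps)
  obtain d0 :: real where d0: "d0 \<ge> 4" and exceptional_le: "\<And>(V :: nat set) (p :: real) j.
      finite V \<Longrightarrow> j \<in> V \<Longrightarrow> p \<le> 1 / 2 \<Longrightarrow> d0 \<le> p * card V \<Longrightarrow> card V \<le> exp (2 * \<gamma> * (p * card V)) \<Longrightarrow>
      EE p (pairs V) (\<lambda>E. ind (exceptional E V j)) \<le> 70 / (p * card V)"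
    using prob_exceptional_le[OF \<gamma>, where 'a = nat] by blast
  \<comment> \<open>The total error at average degree \<open>t\<close> is of order
    \<open>t powr (- 1 / 4)\<close>. At \<open>t = c' * ln n\<close> it is eventually below the
    required bound with constant 1.\<close>
  define err where "err t = 70 / t + 4 * (8 * (70 / t) + sqrt (108 / sqrt t))" for t :: real
  have "c' > 0" "c - c' > 0" using c' by auto
  have "eventually (\<lambda>n::nat. c' * ln (real n) \<ge> max d0 9) at_top"
    using \<open>c' > 0\<close> by real_asymp
  moreover have "eventually (\<lambda>n::nat. c / real n \<le> c - c') at_top"
    using \<open>c - c' > 0\<close> by real_asymp
  moreover have "eventually (\<lambda>n::nat. err (c' * ln (real n)) \<le> ln (ln (real n)) powr (- (1 / 4))) at_top"
    unfolding err_def using \<open>c' > 0\<close> by real_asymp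
  moreover have "eventually (\<lambda>n::nat. n \<ge> 2) at_top" by (rule eventually_ge_at_top)
  ultimately have "eventually (\<lambda>n::nat. c' * ln (real n) \<ge> max d0 9 \<and> c / real n \<le> c - c' \<and>
      err (c' * ln (real n)) \<le> ln (ln (real n)) powr (- (1 / 4)) \<and> n \<ge> 2) at_top"
    by eventually_elim blast
  then obtain N where N: "\<And>n. n \<ge> N \<Longrightarrow> c' * ln (real n) \<ge> max d0 9 \<and> c / real n \<le> c - c' \<and>
      err (c' * ln (real n)) \<le> ln (ln (real n)) powr (- (1 / 4)) \<and> n \<ge> 2"
    unfolding eventually_at_top_linorder by blast
  have "measure_pmf.prob (random_graph n p) {E. vec_space.rank n (adjacency_matrix n E) = n - num_isolated n E}
      \<ge> 1 - ln (ln (real n)) powr (- (1 / 4))"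
    if n: "n \<ge> N" and p: "c * ln (real n) / real n \<le> p" "p \<le> 1 / 2" for n p
  proof -
    define L where "L = c' * ln (real n)"
    have L: "L \<ge> d0" "L \<ge> 9" and nc: "c / real n \<le> c - c'" and errL: "err L \<le> ln (ln (real n)) powr (- (1 / 4))"
      and n2: "n \<ge> 2" using N[OF n] by (auto simp: L_def)
    have ln0: "ln (real n) > 0" using n2 by simp
    have L': "L \<le> p * real (n - 1)"
    proof -
      have "L \<le> (c - c / n) * ln (real n)" unfolding L_def using nc ln0 by (intro mult_right_mono) auto
      also have "\<dots> = c * ln (real n) / n * real (n - 1)" using n2 by (simp add: field_simps of_nat_diff)
      also have "\<dots> \<le> p * real (n - 1)" using p(1) by (intro mult_right_mono) auto
      finally show ?thesis .
    qed
    then have p0: "p > 0" using L by (metis less_le_trans mult_le_0_iff not_less of_nat_0_le_iff order_trans zero_less_numeral)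
    have p01: "0 \<le> p" "p \<le> 1" using p0 p(2) by auto
    have Ln: "L \<le> p * n" using L' p0 n2 mult_left_mono[of "real (n - 1)" "real n" p] by linarith
    have expL: "n \<le> exp (2 * \<gamma> * t)" if "L \<le> t" for t
    proof -
      have "2 * \<gamma> * L = ln (real n)" using c' by (simp add: \<gamma>_def L_def)
      then have "real n = exp (2 * \<gamma> * L)" using n2 by simp
      also have "\<dots> \<le> exp (2 * \<gamma> * t)" using that c' by (simp add: \<gamma>_def divide_right_mono)
      finally show ?thesis .
    qed
    have small: "EE p (pairs V) (\<lambda>E. ind (exceptional E V j)) \<le> 70 / L"
      if "finite V" "j \<in> V" "L \<le> p * card V" "card V \<le> n" for V :: "nat set" and j
    proof -
      have "EE p (pairs V) (\<lambda>E. ind (exceptional E V j)) \<le> 70 / (p * card V)"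
        using that L(1) expL[OF that(3)] by (intro exceptional_le p(2)) auto
      also have "\<dots> \<le> 70 / L" using that(3) L(2) by (intro divide_left_mono) auto
      finally show ?thesis .
    qed
    let ?V = "{1..n}"
    have dep: "EE p (pairs ?V) (\<lambda>E. ind (column_dependent E ?V v)) \<le> 8 * (70 / L) + sqrt (108 / sqrt L)"
      if v: "v \<in> ?V" for v
    proof -
      let ?V' = "?V - {v}"
      have ins: "insert v ?V' = ?V" using v by auto
      have cV': "card ?V' = n - 1" using v by simp
      have LV': "L \<le> p * card ?V'" using L' cV' by simp
      have nine: "9 \<le> p * card ?V'" using LV' L(2) by linarith
      have "EE p (pairs (insert v ?V')) (\<lambda>E. ind (column_dependent E (insert v ?V') v))
          \<le> 8 * (70 / L) + sqrt (108 / sqrt (p * card ?V'))"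
        by (intro prob_column_dependent_le small p0 p(2) nine LV') (use cV' in auto)
      also have "\<dots> \<le> 8 * (70 / L) + sqrt (108 / sqrt L)"
        using LV' L(2) by (intro add_left_mono real_sqrt_le_mono divide_left_mono mult_pos_pos) auto
      finally show ?thesis unfolding ins .
    qed
    have "EE p (pairs ?V) (\<lambda>E. ind (singular E ?V))
      \<le> EE p (pairs ?V) (\<lambda>E. ind (exceptional E ?V 1)) + 4 * (8 * (70 / L) + sqrt (108 / sqrt L))"
      using n2 by (intro prob_singular_le p01 dep) auto
    also have "\<dots> \<le> err L"
      unfolding err_def using n2 Ln by (intro add_right_mono small) auto
    finally have sing: "EE p (pairs ?V) (\<lambda>E. ind (singular E ?V)) \<le> err L" .
    let ?X = "{E. vec_space.rank n (adjacency_matrix n E) = n - num_isolated n E}"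
    have "1 - err L \<le> EE p (pairs ?V) (\<lambda>E. 1 - ind (singular E ?V))"
      using sing by (simp add: EE_diff)
    also have "\<dots> \<le> EE p (pairs ?V) (\<lambda>E. ind (E \<in> ?X))"
    proof (rule EE_mono[OF p01])
      fix E assume "E \<subseteq> pairs ?V"
      then have "E \<subseteq> vertex_pairs n" by (simp add: pairs_def vertex_pairs_def)
      then show "1 - ind (singular E ?V) \<le> ind (E \<in> ?X)"
        using rank_adjacency_matrix by (cases "singular E ?V") auto
    qed
    also have "\<dots> = measure_pmf.prob (random_graph n p) ?X" by (rule prob_random_graph[OF p01, symmetric])
    finally show ?thesis using errL by simp
  qed
  then show ?thesis by (intro exI[of _ 1] conjI exI[of _ N]) auto
qed

end
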